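(* There is an algorithm that, given a set $\mathcal T$ of $m$ state sequences of length $n$ and a set $\mathcal C$ of $k$ criteria that are all independent and monotone decreasing, computes a valid flow diagram for $\mathcal T$ with the minimum possible number of nodes in $O(mnk\cdot T(1,n)+(k+m)(n+1)^m)$ time, where $T(1,n)$ is the time required to check whether a single subsequence of length at most $n$ fulfils a criterion.
   Context: A state sequence is a finite sequence of states. A criterion is a Boolean predicate evaluated on a set of contiguous subsequences (segments) taken from the input state sequences; a set of segments fulfils $C$ if $C$ evaluates to true on it. A criterion $C$ is independent if whether a set of segments fulfils $C$ is determined by checking each segment individually (a predicate on a single subsequence of a single state sequence, without reference to other sequences); a set fulfils $C$ iff each of its segments does. A criterion $C$ is monotone decreasing if whenever a subsequence fulfils $C$, every contiguous subsequence of it also fulfils $C$. A segmentation of a state sequence $\tau$ is a partition of $\tau$ into consecutive nonempty contiguous subsequences, called segments. A flow diagram is a node-labelled directed acyclic graph with a source node $s$ and a sink node $t$, in which every other node is labelled by a criterion from $\mathcal C$; its size is its number of nodes. A flow diagram $F$ is valid for $\mathcal T=\{\tau_1,\dots,\tau_m\}$ if for each $\tau_i$ there is a segmentation $(\sigma_{i,1},\dots,\sigma_{i,r_i})$ of $\tau_i$ and an $s$–$t$ path $s,v_{i,1},\dots,v_{i,r_i},t$ in $F$ such that for every node $v\neq s,t$ of $F$, the set of all segments $\sigma_{i,j}$ with $v_{i,j}=v$ jointly fulfils the criterion labelling $v$. *)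

theory Defs
  imports Main "HOL-Library.Sublist"
begin

section \<open>Criteria and flow diagrams\<close>

type_synonym 's criterion = "'s list set \<Rightarrow> bool"

definition independent_criterion :: "'s criterion \<Rightarrow> bool" where
  "independent_criterion C \<longleftrightarrow> (\<forall>S. C S \<longleftrightarrow> (\<forall>\<sigma>\<in>S. C {\<sigma>}))"

text \<open>\<^const>\<open>sublist\<close> is the relation of being a contiguous subsequence. Segments are
  nonempty, so nothing is required of the empty sequence.\<close>

definition monotone_decreasing_criterion :: "'s criterion \<Rightarrow> bool" where
  "monotone_decreasing_criterion C \<longleftrightarrow>
     (\<forall>\<sigma> \<sigma>'. C {\<sigma>} \<longrightarrow> sublist \<sigma>' \<sigma> \<longrightarrow> \<sigma>' \<noteq> [] \<longrightarrow> C {\<sigma>'})"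

definition segmentation :: "'s list \<Rightarrow> 's list list \<Rightarrow> bool" where
  "segmentation \<tau> \<sigma>s \<longleftrightarrow> concat \<sigma>s = \<tau> \<and> [] \<notin> set \<sigma>s"

text \<open>Nodes are natural numbers; every finite graph has such a copy.
  The label of the source and of the sink is irrelevant.\<close>

record 's flow_diagram =
  fd_nodes :: "nat set"
  fd_edges :: "(nat \<times> nat) set"
  fd_source :: nat
  fd_sink :: nat
  fd_label :: "nat \<Rightarrow> 's criterion"

definition inner_nodes :: "'s flow_diagram \<Rightarrow> nat set" where
  "inner_nodes F = fd_nodes F - {fd_source F, fd_sink F}"

definition is_flow_diagram :: "'s criterion set \<Rightarrow> 's flow_diagram \<Rightarrow> bool" where
  "is_flow_diagram \<C> F \<longleftrightarrow>
     finite (fd_nodes F) \<and>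
     fd_edges F \<subseteq> fd_nodes F \<times> fd_nodes F \<and>
     acyclic (fd_edges F) \<and>
     fd_source F \<in> fd_nodes F \<and> fd_sink F \<in> fd_nodes F \<and> fd_source F \<noteq> fd_sink F \<and>
     (\<forall>v. (v, fd_source F) \<notin> fd_edges F) \<and> (\<forall>v. (fd_sink F, v) \<notin> fd_edges F) \<and>
     (\<forall>v\<in>inner_nodes F. fd_label F v \<in> \<C>)"

definition fd_size :: "'s flow_diagram \<Rightarrow> nat" where
  "fd_size F = card (fd_nodes F)"

definition valid_for :: "'s list list \<Rightarrow> 's flow_diagram \<Rightarrow> bool" where
  "valid_for Ts F \<longleftrightarrow>
     (\<exists>(\<sigma> :: nat \<Rightarrow> 's list list) (v :: nat \<Rightarrow> nat list).
        (\<forall>i<length Ts.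
           segmentation (Ts ! i) (\<sigma> i) \<and>
           length (v i) = length (\<sigma> i) \<and>
           successively (\<lambda>x y. (x, y) \<in> fd_edges F) (fd_source F # v i @ [fd_sink F])) \<and>
        (\<forall>u\<in>inner_nodes F.
           fd_label F u {\<sigma> i ! j | i j. i < length Ts \<and> j < length (\<sigma> i) \<and> v i ! j = u}))"

definition minimum_valid :: "'s criterion set \<Rightarrow> 's list list \<Rightarrow> 's flow_diagram \<Rightarrow> bool" where
  "minimum_valid \<C> Ts F \<longleftrightarrow>
     is_flow_diagram \<C> F \<and> valid_for Ts F \<and>
     (\<forall>F'. is_flow_diagram \<C> F' \<and> valid_for Ts F' \<longrightarrow> fd_size F \<le> fd_size F')"

section \<open>Random access machine with a criterion-checking oracle\<close>

text \<open>
  Algorithms are structured programs for a uniform-cost random access machine over the natural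
  numbers. Apart from control flow, a program can only add, subtract (truncated), compare, access
  registers and memory cells, and query the oracle; there is no unit-cost multiplication.
  Memory is organised as arrays, of which a given program mentions only finitely many.
\<close>

type_synonym name = string
type_synonym state = "(name \<Rightarrow> nat) \<times> (name \<Rightarrow> nat \<Rightarrow> nat)"

datatype aexp =
    Num nat
  | Var name
  | Get name aexp
  | Add aexp aexp
  | Sub aexp aexp

datatype bexp =
    Lt aexp aexp
  | Neg bexp
  | Conj bexp bexp

datatype com =
    Skip
  | Assign name aexp
  | Put name aexp aexp
  | Check name aexp aexp aexp aexp
  | Sequ com com
  | Cond bexp com com
  | Loop bexp com

fun aval :: "aexp \<Rightarrow> state \<Rightarrow> nat" where
  "aval (Num a) s = a"
| "aval (Var x) s = fst s x"
| "aval (Get A e) s = snd s A (aval e s)"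
| "aval (Add e f) s = aval e s + aval f s"
| "aval (Sub e f) s = aval e s - aval f s"

fun bval :: "bexp \<Rightarrow> state \<Rightarrow> bool" where
  "bval (Lt e f) s \<longleftrightarrow> aval e s < aval f s"
| "bval (Neg b) s \<longleftrightarrow> \<not> bval b s"
| "bval (Conj b d) s \<longleftrightarrow> bval b s \<and> bval d s"

fun acost :: "aexp \<Rightarrow> nat" where
  "acost (Num a) = 1"
| "acost (Var x) = 1"
| "acost (Get A e) = 1 + acost e"
| "acost (Add e f) = 1 + acost e + acost f"
| "acost (Sub e f) = 1 + acost e + acost f"

fun bcost :: "bexp \<Rightarrow> nat" where
  "bcost (Lt e f) = 1 + acost e + acost f"
| "bcost (Neg b) = 1 + bcost b"
| "bcost (Conj b d) = 1 + bcost b + bcost d"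

definition set_var :: "name \<Rightarrow> nat \<Rightarrow> state \<Rightarrow> state" where
  "set_var x a s = ((fst s)(x := a), snd s)"

definition set_cell :: "name \<Rightarrow> nat \<Rightarrow> nat \<Rightarrow> state \<Rightarrow> state" where
  "set_cell A i a s = (fst s, (snd s)(A := (snd s A)(i := a)))"

text \<open>An oracle answers a query with a truth value and the time the answer takes; an ill-formed
  query has no answer, and a program issuing one has no execution.\<close>

type_synonym oracle_fun = "nat \<Rightarrow> nat \<Rightarrow> nat \<Rightarrow> nat \<Rightarrow> (bool \<times> nat) option"

text \<open>\<open>exec \<Omega> p s t s'\<close>: started in \<open>s\<close>, program \<open>p\<close> terminates in \<open>s'\<close> after time \<open>t\<close>.\<close>

inductive exec :: "oracle_fun \<Rightarrow> com \<Rightarrow> state \<Rightarrow> nat \<Rightarrow> state \<Rightarrow> bool" for \<Omega> where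
  Skip: "exec \<Omega> Skip s 1 s"
| Assign: "exec \<Omega> (Assign x e) s (1 + acost e) (set_var x (aval e s) s)"
| Put: "exec \<Omega> (Put A e f) s (1 + acost e + acost f) (set_cell A (aval e s) (aval f s) s)"
| Check: "\<Omega> (aval i s) (aval j s) (aval a s) (aval b s) = Some (r, t) \<Longrightarrow>
    exec \<Omega> (Check x i j a b) s (1 + acost i + acost j + acost a + acost b + t)
      (set_var x (of_bool r) s)"
| Sequ: "exec \<Omega> p s t s' \<Longrightarrow> exec \<Omega> q s' u s'' \<Longrightarrow> exec \<Omega> (Sequ p q) s (t + u) s''"
| Cond_True: "bval b s \<Longrightarrow> exec \<Omega> p s t s' \<Longrightarrow> exec \<Omega> (Cond b p q) s (1 + bcost b + t) s'"
| Cond_False: "\<not> bval b s \<Longrightarrow> exec \<Omega> q s t s' \<Longrightarrow> exec \<Omega> (Cond b p q) s (1 + bcost b + t) s'"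
| Loop_False: "\<not> bval b s \<Longrightarrow> exec \<Omega> (Loop b p) s (1 + bcost b) s"
| Loop_True: "bval b s \<Longrightarrow> exec \<Omega> p s t s' \<Longrightarrow> exec \<Omega> (Loop b p) s' u s'' \<Longrightarrow>
    exec \<Omega> (Loop b p) s (1 + bcost b + t + u) s''"

inductive_cases exec_SkipE: "exec \<Omega> Skip s t s'"
inductive_cases exec_AssignE: "exec \<Omega> (Assign x e) s t s'"
inductive_cases exec_PutE: "exec \<Omega> (Put A e f) s t s'"
inductive_cases exec_CheckE: "exec \<Omega> (Check x i j a b) s t s'"
inductive_cases exec_SequE: "exec \<Omega> (Sequ p q) s t s'"
inductive_cases exec_CondE: "exec \<Omega> (Cond b p q) s t s'"
inductive_cases exec_LoopE: "exec \<Omega> (Loop b p) s t s'"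

lemma exec_deterministic:
  "exec \<Omega> p s t s' \<Longrightarrow> exec \<Omega> p s u s'' \<Longrightarrow> u = t \<and> s'' = s'"
proof (induction arbitrary: u s'' rule: exec.induct)
  case (Skip s)
  then show ?case by (auto elim: exec_SkipE)
next
  case (Assign x e s)
  then show ?case by (auto elim: exec_AssignE)
next
  case (Put A e f s)
  then show ?case by (auto elim: exec_PutE)
next
  case (Check i s j a b r t x)
  then show ?case by (auto elim!: exec_CheckE)
next
  case (Sequ p s t s' q v s3)
  from Sequ.prems obtain t2 s2 v2 where
    *: "exec \<Omega> p s t2 s2" "exec \<Omega> q s2 v2 s''" "u = t2 + v2"
    by (rule exec_SequE)
  with Sequ.IH(1)[OF *(1)] Sequ.IH(2) show ?case by simp
next
  case (Cond_True b s p t s' q)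
  from Cond_True.prems Cond_True.hyps obtain t2 where
    *: "exec \<Omega> p s t2 s''" "u = 1 + bcost b + t2"
    by (auto elim!: exec_CondE)
  with Cond_True.IH[OF *(1)] show ?case by simp
next
  case (Cond_False b s q t s' p)
  from Cond_False.prems Cond_False.hyps obtain t2 where
    *: "exec \<Omega> q s t2 s''" "u = 1 + bcost b + t2"
    by (auto elim!: exec_CondE)
  with Cond_False.IH[OF *(1)] show ?case by simp
next
  case (Loop_False b s p)
  from Loop_False.prems show ?case
    by (rule exec_LoopE) (simp_all add: Loop_False.hyps)
next
  case (Loop_True b s p t s' v s3)
  from Loop_True.prems obtain t2 s2 v2 where
    *: "exec \<Omega> p s t2 s2" "exec \<Omega> (Loop b p) s2 v2 s''" "u = 1 + bcost b + t2 + v2"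
    by (rule exec_LoopE) (use Loop_True.hyps(1) in simp_all)
  with Loop_True.IH(1)[OF *(1)] Loop_True.IH(2) show ?case by simp
qed

section \<open>Input and output\<close>

text \<open>The states themselves are accessible only by checking criteria: the query \<open>i j a b\<close> asks
  whether the nonempty contiguous subsequence of the \<open>i\<close>-th sequence at the positions
  \<open>a, \<dots>, b - 1\<close> fulfils the \<open>j\<close>-th criterion. The time of such a check is given by \<open>\<theta>\<close>.\<close>

definition check_oracle ::
  "'s list list \<Rightarrow> 's criterion list \<Rightarrow> ('s criterion \<Rightarrow> 's list \<Rightarrow> nat) \<Rightarrow> oracle_fun" where
  "check_oracle Ts Cs \<theta> i j a b =
     (if i < length Ts \<and> j < length Cs \<and> a < b \<and> b \<le> length (Ts ! i)
      then (let \<sigma> = take (b - a) (drop a (Ts ! i)) in Some ((Cs ! j) {\<sigma>}, \<theta> (Cs ! j) \<sigma>))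
      else None)"

definition input_state :: "nat \<Rightarrow> nat \<Rightarrow> nat \<Rightarrow> state" where
  "input_state m n k =
     ((\<lambda>_. 0)(''m'' := m, ''n'' := n, ''k'' := k), (\<lambda>_ _. 0))"

text \<open>A computed diagram has nodes \<open>0, \<dots>, nodes - 1\<close>, is given by its list of edges, and
  labels each inner node by an index into the list of criteria.\<close>

definition outputs_diagram :: "'s criterion list \<Rightarrow> state \<Rightarrow> 's flow_diagram \<Rightarrow> bool" where
  "outputs_diagram Cs s F \<longleftrightarrow>
     fst s ''found'' = 1 \<and>
     fd_nodes F = {..<fst s ''nodes''} \<and>
     fd_edges F = {(snd s ''tail'' e, snd s ''head'' e) | e. e < fst s ''edges''} \<and>
     fd_source F = fst s ''source'' \<and>
     fd_sink F = fst s ''sink'' \<and>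
     (\<forall>v\<in>inner_nodes F. snd s ''label'' v < length Cs \<and> fd_label F v = Cs ! snd s ''label'' v)"

definition outputs_infeasible :: "state \<Rightarrow> bool" where
  "outputs_infeasible s \<longleftrightarrow> fst s ''found'' = 0"

end

theory Submission
  imports Defs
begin

text \<open>
  For independent criteria, the inner nodes of a valid diagram in topological order yield a word of
  criteria that every sequence can be cut along, skipping nodes where it likes; for decreasing
  criteria it is optimal for each sequence to take the longest possible segment at each letter.
  So a minimum diagram is a shortest word whose greedy run empties all sequences at once, and this is
  a shortest path problem on the \<open>(n + 1) ^ m\<close> vectors of remaining lengths.

  A vector is coded by the number whose digits to the base \<open>n + 1\<close> are the remaining lengths. The
  code of the successor under a criterion is a sum of one term per digit, so it is obtained in constant
  time from the successor of the code without its leading digit; this replaces a factor \<open>k * m\<close>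
  by \<open>k\<close>. Codes decrease along steps, so distances are computed in the same increasing sweep.
  The terms of the sum are found by a two-pointer scan with at most \<open>2 * n\<close> checks for each
  sequence and criterion.
\<close>

section \<open>Topological orders and digits\<close>

lemma independent_criterionD: "independent_criterion C \<Longrightarrow> \<sigma> \<in> S \<Longrightarrow> C S \<Longrightarrow> C {\<sigma>}"
  unfolding independent_criterion_def by blast

lemma independent_criterionI: "independent_criterion C \<Longrightarrow> (\<And>\<sigma>. \<sigma> \<in> S \<Longrightarrow> C {\<sigma>}) \<Longrightarrow> C S"
  unfolding independent_criterion_def by blast

text \<open>Take out an element of \<open>A\<close> without predecessor in \<open>A\<close> and
  recurse. It exists since \<open>E\<close> restricted to \<open>A\<close> is finite and acyclic,
  hence well-founded; \<open>E\<close> itself may be infinite.\<close>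

lemma finite_acyclic_topological_list:
  assumes "finite A" "acyclic E"
  shows "\<exists>ws. distinct ws \<and> set ws = A \<and> sorted_wrt (\<lambda>x y. (y, x) \<notin> E) ws"
  using assms(1)
proof (induction "card A" arbitrary: A)
  case 0
  then show ?case by (intro exI[of _ "[]"]) auto
next
  case (Suc c)
  have "wf (E \<inter> A \<times> A)"
    by (rule finite_acyclic_wf)
      (use Suc.prems assms(2) in \<open>auto intro: acyclic_subset\<close>)
  moreover from Suc.hyps(2) obtain a where "a \<in> A" by fastforce
  ultimately obtain z where z: "z \<in> A" "\<And>y. (y, z) \<in> E \<inter> A \<times> A \<Longrightarrow> y \<notin> A"
    by (metis wfE_min)
  then have z': "\<And>y. y \<in> A \<Longrightarrow> (y, z) \<notin> E" by blast
  have "c = card (A - {z})" using Suc.hyps(2) Suc.prems z(1) by simp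
  from Suc.hyps(1)[OF this] Suc.prems obtain ws where
    ws: "distinct ws" "set ws = A - {z}" "sorted_wrt (\<lambda>x y. (y, x) \<notin> E) ws" by auto
  have "sorted_wrt (\<lambda>x y. (y, x) \<notin> E) (z # ws)" using ws z' by auto
  then show ?case using ws z(1) by (intro exI[of _ "z # ws"]) auto
qed

lemma subseq_of_sorted_wrt:
  assumes "sorted_wrt (\<lambda>x y. (x, y) \<in> R) vs" "set vs \<subseteq> set ws"
    "sorted_wrt (\<lambda>x y. (y, x) \<notin> R) ws" "irrefl R"
  shows "subseq vs ws"
  using assms(1-3)
proof (induction ws arbitrary: vs)
  case (Cons w ws)
  show ?case
  proof (cases vs)
    case (Cons v vs')
    show ?thesis
    proof (cases "v = w")
      case True
      then have "w \<notin> set vs'" using Cons.prems(1) assms(4) Cons by (auto simp: irrefl_def)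
      then show ?thesis using Cons.IH[of vs'] Cons.prems Cons True by auto
    next
      case False
      then have "w \<notin> set vs" using Cons.prems Cons by auto
      then show ?thesis using Cons.IH[of vs] Cons.prems Cons False by auto
    qed
  qed simp
qed simp

text \<open>The source has no incoming and the sink no outgoing edge, so this makes every node
  strictly inside an s-t path an inner node.\<close>

lemma successively_path_inner:
  assumes "successively (\<lambda>x y. (x, y) \<in> E) (s # vs @ [t])" "v \<in> set vs"
  shows "(\<exists>u. (u, v) \<in> E) \<and> (\<exists>u. (v, u) \<in> E)"
proof -
  from assms(2) obtain a b where vs: "vs = a @ v # b" by (meson split_list)
  have "successively (\<lambda>x y. (x, y) \<in> E) ((s # a) @ v # b @ [t])" using assms(1) vs by simp
  then have "(last (s # a), v) \<in> E" "successively (\<lambda>x y. (x, y) \<in> E) (v # b @ [t])"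
    unfolding successively_append_iff by auto
  then show ?thesis by (cases b) auto
qed

text \<open>The isolated factor \<open>b\<close> shows that adding a multiple of
  \<open>b ^ M\<close> leaves digit \<open>l\<close> unchanged.\<close>

lemma power_split:
  fixes b :: nat
  assumes "l < M"
  shows "b ^ M = b ^ l * (b * b ^ (M - l - 1))"
proof -
  from assms obtain c where "M = Suc (l + c)" using less_imp_Suc_add by blast
  then show ?thesis by (simp add: power_add)
qed

lemma sum_digits:
  fixes q b :: nat
  shows "(\<Sum>i<M. (q div b ^ i mod b) * b ^ i) = q mod b ^ M"
proof (induction M)
  case (Suc M)
  have "q mod b ^ Suc M = q mod (b ^ M * b)" by (simp add: mult.commute)
  also have "\<dots> = b ^ M * (q div b ^ M mod b) + q mod b ^ M" by (rule mod_mult2_eq)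
  finally show ?case using Suc by simp
qed simp

lemma sum_digits_less:
  fixes x :: "nat \<Rightarrow> nat"
  assumes "\<And>i. i < M \<Longrightarrow> x i < b"
  shows "(\<Sum>i<M. x i * b ^ i) < b ^ M"
  using assms
proof (induction M)
  case (Suc M)
  have "(\<Sum>i<M. x i * b ^ i) + x M * b ^ M < (x M + 1) * b ^ M" using Suc by simp
  also have "\<dots> \<le> b * b ^ M" using Suc.prems[of M] by (intro mult_right_mono) auto
  finally show ?case by simp
qed simp

lemma digit_of_sum:
  fixes x :: "nat \<Rightarrow> nat"
  assumes "\<And>i. i < M \<Longrightarrow> x i < b" "l < M"
  shows "(\<Sum>i<M. x i * b ^ i) div b ^ l mod b = x l"
  using assms
proof (induction M)
  case (Suc M)
  have b: "b > 0" using Suc.prems by fastforce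
  show ?case
  proof (cases "l = M")
    case True
    have "(\<Sum>i<M. x i * b ^ i) < b ^ M" using Suc by (intro sum_digits_less) auto
    then show ?thesis using True Suc.prems(1)[of M] b by simp
  next
    case False
    then have l: "l < M" using Suc.prems by simp
    then have "b ^ M = b ^ l * (b * b ^ (M - l - 1))"
      by (rule power_split)
    then have q: "(\<Sum>i<Suc M. x i * b ^ i) = (\<Sum>i<M. x i * b ^ i) + b ^ l * (b * (b ^ (M - l - 1) * x M))"
      by simp
    have "(\<Sum>i<Suc M. x i * b ^ i) div b ^ l = (\<Sum>i<M. x i * b ^ i) div b ^ l + b * (b ^ (M - l - 1) * x M)"
      unfolding q using b by (subst div_mult_self2) simp_all
    then show ?thesis using Suc l by simp
  qed
qed simp

section \<open>Greedy segmentations and minimum diagrams\<close>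

text \<open>Excludes idle letters. This bounds the length of a word and, for a single sequence,
  makes every node of the chain carry a segment.\<close>

fun progress :: "(nat \<Rightarrow> nat \<Rightarrow> nat) \<Rightarrow> nat list \<Rightarrow> nat \<Rightarrow> bool" where
  "progress f [] x \<longleftrightarrow> True"
| "progress f (j # js) x \<longleftrightarrow> f j x \<noteq> x \<and> progress f js (f j x)"

locale flow_instance =
  fixes Ts :: "'s list list" and Cs :: "'s criterion list" and n :: nat
  assumes length_Ts: "\<And>\<tau>. \<tau> \<in> set Ts \<Longrightarrow> length \<tau> = n"
    and indep: "\<And>C. C \<in> set Cs \<Longrightarrow> independent_criterion C"
    and decr: "\<And>C. C \<in> set Cs \<Longrightarrow> monotone_decreasing_criterion C"
begin

abbreviation "m \<equiv> length Ts"
abbreviation "k \<equiv> length Cs"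
abbreviation "B \<equiv> Suc n"

definition holds :: "nat \<Rightarrow> nat \<Rightarrow> nat \<Rightarrow> nat \<Rightarrow> bool" where
  "holds i j a b \<longleftrightarrow> (Cs ! j) {take (b - a) (drop a (Ts ! i))}"

text \<open>\<open>rest i j d\<close> is the length that remains of the last \<open>d\<close> states of the \<open>i\<close>-th sequence after
  removing from the front the longest segment that fulfils the \<open>j\<close>-th criterion, if there is any.\<close>

definition rest :: "nat \<Rightarrow> nat \<Rightarrow> nat \<Rightarrow> nat" where
  "rest i j d = (LEAST e. e = d \<or> e < d \<and> holds i j (n - d) (n - e))"

lemma rest_cases: "rest i j d = d \<or> rest i j d < d \<and> holds i j (n - d) (n - rest i j d)"
  unfolding rest_def by (rule LeastI[of _ d]) simp

lemma rest_le: "rest i j d \<le> d"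
  using rest_cases[of i j d] by auto

lemma rest_zero [simp]: "rest i j 0 = 0"
  using rest_le[of i j 0] by simp

lemma rest_least: "e < d \<Longrightarrow> holds i j (n - d) (n - e) \<Longrightarrow> rest i j d \<le> e"
  unfolding rest_def by (rule Least_le) simp

text \<open>The exchange property behind greedy cutting. If the longest segment from the earlier
  position reaches beyond the later one, its part from there on is nonempty and fulfils the
  decreasing criterion; otherwise \<open>rest i j d'\<close> is at least \<open>d\<close>
  anyway.\<close>

lemma rest_mono:
  assumes "i < m" "j < k" "d \<le> d'" "d' \<le> n"
  shows "rest i j d \<le> rest i j d'"
proof (cases "rest i j d' < d")
  case True
  let ?e = "rest i j d'" and ?\<tau> = "Ts ! i"
  have l: "length ?\<tau> = n" using length_Ts assms(1) by simp
  have h: "holds i j (n - d') (n - ?e)" using rest_cases[of i j d'] True assms(3) by auto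
  have "take (n - ?e - (n - d)) (drop (n - d) ?\<tau>)
      = drop (d' - d) (take (n - ?e - (n - d')) (drop (n - d') ?\<tau>))"
    using assms True by (simp add: drop_take algebra_simps)
  then have "sublist (take (n - ?e - (n - d)) (drop (n - d) ?\<tau>))
      (take (n - ?e - (n - d')) (drop (n - d') ?\<tau>))" by (metis sublist_drop)
  moreover have "take (n - ?e - (n - d)) (drop (n - d) ?\<tau>) \<noteq> []" using l assms True by simp
  ultimately have "holds i j (n - d) (n - ?e)"
    using h decr[of "Cs ! j"] assms(2)
    unfolding holds_def monotone_decreasing_criterion_def by auto
  then show ?thesis using True by (simp add: rest_least)
next
  case False
  then show ?thesis using rest_le[of i j d] by linarith
qed

section \<open>Vectors of remaining lengths as numbers to the base \<open>n + 1\<close>\<close>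

definition dig :: "nat \<Rightarrow> nat \<Rightarrow> nat" where
  "dig q i = q div B ^ i mod B"

lemma dig_le: "dig q i \<le> n"
  unfolding dig_def using mod_less_divisor[of B "q div B ^ i"] by simp

lemma sum_dig: "q < B ^ m \<Longrightarrow> (\<Sum>i<m. dig q i * B ^ i) = q"
  unfolding dig_def by (simp add: sum_digits del: power_Suc)

lemma dig_eqI:
  assumes "q < B ^ m" "q' < B ^ m" "\<And>i. i < m \<Longrightarrow> dig q i = dig q' i"
  shows "q = q'"
proof -
  have "(\<Sum>i<m. dig q i * B ^ i) = (\<Sum>i<m. dig q' i * B ^ i)"
    by (rule sum.cong) (simp_all only: assms(3) lessThan_iff)
  then show ?thesis using sum_dig assms(1,2) by simp
qed

definition advance :: "nat \<Rightarrow> nat \<Rightarrow> nat" where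
  "advance j q = (\<Sum>i<m. rest i j (dig q i) * B ^ i)"

lemma rest_dig_less: "rest i j (dig q i) < B"
  using rest_le[of i j "dig q i"] dig_le[of q i] by linarith

lemma dig_advance: "i < m \<Longrightarrow> dig (advance j q) i = rest i j (dig q i)"
  unfolding advance_def by (subst dig_def, rule digit_of_sum) (auto intro: rest_dig_less)

lemma advance_less: "advance j q < B ^ m"
  unfolding advance_def by (rule sum_digits_less) (rule rest_dig_less)

lemma advance_le: "q < B ^ m \<Longrightarrow> advance j q \<le> q"
  unfolding advance_def by (subst (2) sum_dig[symmetric]) (auto intro!: sum_mono rest_le)

lemma advance_0: "advance j 0 = 0"
  unfolding advance_def by (simp add: dig_def)

text \<open>The source of constant-time successors: a leading digit at position \<open>i\<close>
  does not disturb the digits of \<open>r\<close>, and the digits above it are \<open>0\<close>, a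
  value that \<open>rest\<close> preserves.\<close>

lemma advance_step:
  assumes "i < m" "d \<le> n" "r < B ^ i"
  shows "advance j (d * B ^ i + r) = advance j r + rest i j d * B ^ i"
proof -
  let ?q = "d * B ^ i + r"
  have lo: "dig ?q l = dig r l" if "l < i" for l
  proof -
    have "B ^ i = B ^ l * (B * B ^ (i - l - 1))"
      using that by (rule power_split)
    then have q: "?q = r + B ^ l * (B * (B ^ (i - l - 1) * d))"
      by (simp only: ac_simps)
    have "?q div B ^ l = r div B ^ l + B * (B ^ (i - l - 1) * d)"
      unfolding q by (subst div_mult_self2) simp_all
    then show ?thesis unfolding dig_def by (metis mod_mult_self2)
  qed
  have hi: "dig ?q l = 0 \<and> dig r l = 0" if "i < l" for l
  proof -
    have "?q < (d + 1) * B ^ i" unfolding add_mult_distrib mult_1 using assms(3) by linarith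
    also have "\<dots> \<le> B * B ^ i" using assms by (intro mult_right_mono) auto
    also have "\<dots> \<le> B ^ l" using that power_increasing[of "Suc i" l B] by simp
    finally show ?thesis unfolding dig_def by (simp add: div_less)
  qed
  have at: "dig ?q i = d" "dig r i = 0" using assms by (simp_all add: dig_def)
  have "advance j ?q = (\<Sum>l<m. rest l j (dig r l) * B ^ l + (if l = i then rest i j d * B ^ i else 0))"
    unfolding advance_def
  proof (rule sum.cong[OF refl])
    fix l
    show "rest l j (dig ?q l) * B ^ l
      = rest l j (dig r l) * B ^ l + (if l = i then rest i j d * B ^ i else 0)"
      using lo[of l] hi[of l] at by (cases l i rule: linorder_cases) auto
  qed
  then show ?thesis using assms(1) by (simp add: sum.distrib advance_def)
qed

text \<open>The code with all digits \<open>n\<close>: no sequence has been cut yet.\<close>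

definition start :: nat where
  "start = B ^ m - 1"

lemma start_less: "start < B ^ m"
  unfolding start_def by simp

lemma dig_start: "i < m \<Longrightarrow> dig start i = n"
proof -
  assume i: "i < m"
  have "(\<Sum>i<M. n * B ^ i) = B ^ M - 1" for M
    by (induction M) (auto simp: algebra_simps)
  then have "start = (\<Sum>i<m. n * B ^ i)" unfolding start_def by metis
  then show ?thesis unfolding dig_def using digit_of_sum[of m "\<lambda>_. n" B i] i by simp
qed

lemma fold_advance_less: "q < B ^ m \<Longrightarrow> fold advance js q < B ^ m"
  by (induction js arbitrary: q) (auto simp: advance_less simp del: power_Suc)

lemma dig_fold_advance: "i < m \<Longrightarrow> dig (fold advance js q) i = fold (rest i) js (dig q i)"
  by (induction js arbitrary: q) (auto simp: dig_advance)

lemma fold_advance_0_iff: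
  "q < B ^ m \<Longrightarrow> fold advance js q = 0 \<longleftrightarrow> (\<forall>i<m. fold (rest i) js (dig q i) = 0)"
proof -
  assume q: "q < B ^ m"
  have "fold advance js q = 0 \<longleftrightarrow> (\<forall>i<m. dig (fold advance js q) i = dig 0 i)"
    using dig_eqI[of "fold advance js q" 0] fold_advance_less[OF q, of js] by auto
  then show ?thesis by (simp add: dig_fold_advance) (simp add: dig_def)
qed

section \<open>Distances to the code \<open>0\<close> and shortest words\<close>

definition reach :: "nat \<Rightarrow> nat \<Rightarrow> bool" where
  "reach L q \<longleftrightarrow> (\<exists>js. length js = L \<and> set js \<subseteq> {..<k} \<and> fold advance js q = 0)"

lemma reach_0: "reach 0 q \<longleftrightarrow> q = 0"
  unfolding reach_def by auto

lemma reach_Suc: "reach (Suc L) q \<longleftrightarrow> (\<exists>j<k. reach L (advance j q))"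
proof
  assume "reach (Suc L) q"
  then obtain js where js: "length js = Suc L" "set js \<subseteq> {..<k}" "fold advance js q = 0"
    unfolding reach_def by auto
  then show "\<exists>j<k. reach L (advance j q)" unfolding reach_def by (cases js) auto
next
  assume "\<exists>j<k. reach L (advance j q)"
  then obtain j js where "j < k" "length js = L" "set js \<subseteq> {..<k}"
    "fold advance js (advance j q) = 0" unfolding reach_def by auto
  then show "reach (Suc L) q" unfolding reach_def by (intro exI[of _ "j # js"]) auto
qed

text \<open>One more than the distance to \<open>0\<close>; unreachable codes get the initial content of the memory.\<close>

definition opt :: "nat \<Rightarrow> nat" where
  "opt q = (if \<exists>L. reach L q then Suc (LEAST L. reach L q) else 0)"

lemma opt_0: "opt 0 = 1"
proof -
  have "reach 0 0" by (simp add: reach_0)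
  then have "(LEAST L. reach L 0) = 0" by (metis Least_eq_0)
  then show ?thesis unfolding opt_def using \<open>reach 0 0\<close> by auto
qed

lemma opt_reach: "opt q = Suc L \<Longrightarrow> reach L q"
  unfolding opt_def by (auto split: if_splits intro: LeastI)

lemma opt_le: "reach L q \<Longrightarrow> 0 < opt q \<and> opt q \<le> Suc L"
  unfolding opt_def by (auto intro: Least_le)

lemma opt_eqI: "reach L q \<Longrightarrow> (\<And>L'. reach L' q \<Longrightarrow> L \<le> L') \<Longrightarrow> opt q = Suc L"
  unfolding opt_def by (auto intro: Least_equality)

text \<open>The content of \<open>D\<close> when the sweep stands at \<open>q\<close>. The cells
  from \<open>q\<close> on still hold the initial \<open>0\<close>, so an idle letter at
  \<open>q\<close> looks like one that leads to an unreachable code.\<close>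

definition opt_below :: "nat \<Rightarrow> nat \<Rightarrow> nat" where
  "opt_below q z = (if z < q then opt z else 0)"

text \<open>The Bellman equation for one cell: \<open>b\<close> is the least positive value stored
  for a successor, or \<open>0\<close> if there is none. Words may contain idle letters, which is
  why the comparison with them is an induction on their length.\<close>

lemma opt_eq_best:
  assumes q: "0 < q" "q < B ^ m"
    and lower: "\<And>j. j < k \<Longrightarrow> 0 < opt_below q (advance j q) \<Longrightarrow> 0 < b \<and> b \<le> opt_below q (advance j q)"
    and attained: "0 < b \<Longrightarrow> l < k \<and> opt_below q (advance l q) = b"
  shows "opt q = (if 0 < b then Suc b else 0)"
proof -
  have *: "0 < b \<and> b \<le> L" if "reach L q" for L
    using that
  proof (induction L)
    case 0
    then show ?case using q by (simp add: reach_0)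
  next
    case (Suc L)
    then obtain j where j: "j < k" "reach L (advance j q)" by (auto simp: reach_Suc)
    show ?case
    proof (cases "advance j q = q")
      \<comment> \<open>The first letter is idle, so the shorter remaining word already leads from
        \<open>q\<close> to \<open>0\<close>.\<close>
      case True
      then show ?thesis using Suc j by auto
    next
      case False
      then have "advance j q < q" using advance_le[of q j] q by simp
      then have "opt_below q (advance j q) = opt (advance j q)" by (simp add: opt_below_def)
      then show ?thesis using lower[OF j(1)] opt_le[OF j(2)] by auto
    qed
  qed
  show ?thesis
  proof (cases "0 < b")
    case True
    then have l: "l < k" "opt_below q (advance l q) = b" using attained by auto
    then have "opt (advance l q) = Suc (b - 1)" using True by (auto simp: opt_below_def split: if_splits)
    then have "reach (Suc (b - 1)) q" using l opt_reach reach_Suc by blast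
    then show ?thesis using True * opt_eqI by simp
  next
    case False
    then show ?thesis using * by (auto simp: opt_def)
  qed
qed

text \<open>A shortest path tree, stored as a letter and a successor for each reachable code, so
  that each letter of a shortest word is read off in constant time.\<close>

definition linked :: "nat \<Rightarrow> (nat \<Rightarrow> nat) \<Rightarrow> (nat \<Rightarrow> nat) \<Rightarrow> bool" where
  "linked N l x \<longleftrightarrow> (\<forall>q. 0 < q \<longrightarrow> q < N \<longrightarrow> 0 < opt q \<longrightarrow>
     l q < k \<and> x q = advance (l q) q \<and> opt q = Suc (opt (advance (l q) q)))"

text \<open>Following the pointers lowers \<open>opt\<close> by one each time, so \<open>0\<close>
  is reached after \<open>L\<close> letters. None of them is idle, since an unchanged code would
  have an unchanged distance.\<close>

lemma linked_chain:
  assumes "linked (B ^ m) l x" "q < B ^ m" "opt q = Suc L"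
  defines "js \<equiv> map (\<lambda>t. l ((x ^^ t) q)) [0..<L]"
  shows "set js \<subseteq> {..<k} \<and> fold advance js q = 0 \<and> progress advance js q"
  unfolding js_def using assms(2,3)
proof (induction L arbitrary: q)
  case 0
  then show ?case using opt_reach[of q 0] by (simp add: reach_0)
next
  case (Suc L)
  then have "q > 0" using opt_0 by (cases q) auto
  then have "l q < k \<and> x q = advance (l q) q \<and> opt q = Suc (opt (advance (l q) q))"
    using assms(1) Suc.prems unfolding linked_def by (metis zero_less_Suc)
  then have l: "l q < k" "x q = advance (l q) q" "opt q = Suc (opt (x q))" by simp_all
  then have o: "opt (x q) = Suc L" using Suc.prems by simp
  have "x q < B ^ m" using l advance_less by simp
  note IH = Suc.IH[OF this o]
  have "map (\<lambda>t. l ((x ^^ t) q)) [0..<Suc L] = l q # map (\<lambda>t. l ((x ^^ t) (x q))) [0..<L]"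
    by (simp add: upt_conv_Cons map_Suc_upt[symmetric] funpow_swap1 del: upt_Suc)
  moreover have "advance (l q) q \<noteq> q" using l(2) o Suc.prems(2) by auto
  ultimately show ?case using IH l(1,2) by (simp del: upt_Suc)
qed

text \<open>No digit grows, and one falls strictly because the code changes; so every letter lowers
  the digit sum.\<close>

lemma progress_length:
  "q < B ^ m \<Longrightarrow> progress advance js q \<Longrightarrow> length js \<le> (\<Sum>i<m. dig q i)"
proof (induction js arbitrary: q)
  case (Cons j js)
  have "\<exists>i<m. dig (advance j q) i \<noteq> dig q i"
    using dig_eqI[OF advance_less Cons.prems(1), of j] Cons.prems by auto
  then have "(\<Sum>i<m. dig (advance j q) i) < (\<Sum>i<m. dig q i)"
    by (intro sum_strict_mono_ex1) (auto simp: dig_advance rest_le order.strict_iff_order)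
  then show ?case using Cons.IH[OF advance_less, of j q] Cons.prems by auto
qed simp

lemma progress_start_length: "progress advance js start \<Longrightarrow> length js \<le> m * n"
  using progress_length[OF start_less] by (simp add: dig_start)

lemma progress_single:
  assumes "m = 1"
  shows "q \<le> n \<Longrightarrow> progress advance js q \<Longrightarrow> progress (rest 0) js q"
proof (induction js arbitrary: q)
  case (Cons j js)
  have "advance j q = rest 0 j q" using assms Cons.prems(1) by (simp add: advance_def dig_def)
  then show ?case using Cons rest_le[of 0 j q] by (auto intro: order.trans)
qed simp

text \<open>Greedy stays ahead: its remainder \<open>x\<close> never exceeds the remainder
  \<open>d\<close> of the given segmentation, whose segments lie at the nodes \<open>vs\<close>. At
  a node that the path skips, greedy may still cut, which only lowers \<open>x\<close>; at a node
  that it uses, \<open>rest_mono\<close> carries its segment over to the greedy run.\<close>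

lemma fold_rest_zero:
  assumes "i < m"
  shows "list_all2 (\<lambda>v s. (Cs ! lab v) {s}) vs segs \<Longrightarrow> subseq vs ws \<Longrightarrow>
    concat segs = drop (n - d) (Ts ! i) \<Longrightarrow> [] \<notin> set segs \<Longrightarrow> x \<le> d \<Longrightarrow> d \<le> n \<Longrightarrow>
    lab ` set ws \<subseteq> {..<k} \<Longrightarrow> fold (rest i) (map lab ws) x = 0"
proof (induction ws arbitrary: vs segs x d)
  case Nil
  have "length (Ts ! i) = n" using assms length_Ts by simp
  moreover have "segs = []" using Nil by (auto dest: list_emb_Nil2)
  ultimately show ?case using Nil by auto
next
  case (Cons w ws)
  have l: "length (Ts ! i) = n" using assms length_Ts by simp
  have w: "lab w < k" using Cons.prems by auto
  show ?case
  proof (cases "subseq vs ws")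
    case True
    have "fold (rest i) (map lab ws) (rest i (lab w) x) = 0"
      using Cons.prems rest_le[of i "lab w" x] by (intro Cons.IH[OF _ True, of segs d]) auto
    then show ?thesis by simp
  next
    case False
    then obtain vs' where vs: "vs = w # vs'" "subseq vs' ws"
      using Cons.prems(2) by (cases vs) (auto split: if_splits)
    then obtain s segs' where segs: "segs = s # segs'" "(Cs ! lab w) {s}"
      "list_all2 (\<lambda>v s. (Cs ! lab v) {s}) vs' segs'"
      using Cons.prems(1) by (auto simp: list_all2_Cons1)
    have eq: "s @ concat segs' = drop (n - d) (Ts ! i)" using Cons.prems segs by simp
    have "length s + length (concat segs') = d"
      using arg_cong[OF eq, of length] l Cons.prems(6) by simp
    then have ls: "length s \<le> d" "length s > 0" using Cons.prems segs by auto
    have s: "s = take (length s) (drop (n - d) (Ts ! i))" using eq by (metis append_eq_conv_conj)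
    have "concat segs' = drop (length s) (drop (n - d) (Ts ! i))" using eq by (metis append_eq_conv_conj)
    then have c: "concat segs' = drop (n - (d - length s)) (Ts ! i)"
      using ls Cons.prems(6) by (simp add: algebra_simps)
    have "n - (d - length s) - (n - d) = length s" using ls Cons.prems by simp
    then have "holds i (lab w) (n - d) (n - (d - length s))"
      unfolding holds_def using s segs by metis
    then have "rest i (lab w) d \<le> d - length s" using ls by (intro rest_least) linarith+
    then have "rest i (lab w) x \<le> d - length s"
      using rest_mono[OF assms w Cons.prems(5,6)] by linarith
    then have "fold (rest i) (map lab ws) (rest i (lab w) x) = 0"
      using Cons.prems segs vs by (intro Cons.IH[OF segs(3) vs(2) c]) auto
    then show ?thesis by simp
  qed
qed

text \<open>The lower bound on the size. The labels of the inner nodes in topological order form a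
  word that empties all sequences; source and sink account for the \<open>2\<close>.\<close>

lemma valid_diagram_reach:
  assumes F: "is_flow_diagram (set Cs) F" and V: "valid_for Ts F"
  shows "\<exists>L. reach L start \<and> fd_size F = L + 2"
proof -
  let ?E = "fd_edges F"
  have fin: "finite (inner_nodes F)" using F by (simp add: is_flow_diagram_def inner_nodes_def)
  have "acyclic (?E\<^sup>+)" using F by (simp add: is_flow_diagram_def acyclic_def)
  \<comment> \<open>Sorting along the transitive closure orders any two nodes of a path, not only
    consecutive ones.\<close>
  from finite_acyclic_topological_list[OF fin this] obtain ws where
    ws: "distinct ws" "set ws = inner_nodes F" "sorted_wrt (\<lambda>x y. (y, x) \<notin> ?E\<^sup>+) ws" by auto
  have "\<forall>v\<in>inner_nodes F. \<exists>j<k. Cs ! j = fd_label F v"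
    using F by (simp add: is_flow_diagram_def in_set_conv_nth)
  then obtain lab where lab: "\<And>v. v \<in> inner_nodes F \<Longrightarrow> lab v < k \<and> Cs ! lab v = fd_label F v"
    by metis
  obtain \<sigma> v where
    seg: "\<And>i. i < m \<Longrightarrow> segmentation (Ts ! i) (\<sigma> i) \<and> length (v i) = length (\<sigma> i) \<and>
           successively (\<lambda>x y. (x, y) \<in> ?E) (fd_source F # v i @ [fd_sink F])" and
    ful: "\<And>u. u \<in> inner_nodes F \<Longrightarrow>
           fd_label F u {\<sigma> i ! j | i j. i < m \<and> j < length (\<sigma> i) \<and> v i ! j = u}"
    using V[unfolded valid_for_def] by auto
  have "fold (rest i) (map lab ws) (dig start i) = 0" if i: "i < m" for i
  proof -
    have path: "successively (\<lambda>x y. (x, y) \<in> ?E) (fd_source F # v i @ [fd_sink F])"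
      using seg i by simp
    have inner: "set (v i) \<subseteq> inner_nodes F"
    proof
      fix u assume "u \<in> set (v i)"
      from successively_path_inner[OF path this] F show "u \<in> inner_nodes F"
        unfolding is_flow_diagram_def inner_nodes_def by blast
    qed
    have "successively (\<lambda>x y. (x, y) \<in> ?E) (v i)"
      using path by (auto simp: successively_Cons successively_append_iff)
    then have "successively (\<lambda>x y. (x, y) \<in> ?E\<^sup>+) (v i)"
      by (rule successively_mono) auto
    then have "sorted_wrt (\<lambda>x y. (x, y) \<in> ?E\<^sup>+) (v i)"
      by (subst (asm) successively_iff_sorted_wrt_strong) (auto intro: trancl_trans)
    then have sub: "subseq (v i) ws"
      using inner ws F
      by (intro subseq_of_sorted_wrt[of "?E\<^sup>+"]) (auto simp: irrefl_def is_flow_diagram_def acyclic_def)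
    have "list_all2 (\<lambda>v s. (Cs ! lab v) {s}) (v i) (\<sigma> i)"
      unfolding list_all2_conv_all_nth
    proof (intro conjI allI impI)
      show "length (v i) = length (\<sigma> i)" using seg i by simp
      fix l assume l: "l < length (v i)"
      let ?u = "v i ! l"
      have u: "?u \<in> inner_nodes F" using l inner by auto
      have "fd_label F ?u \<in> set Cs" using F u by (simp add: is_flow_diagram_def)
      \<comment> \<open>Independence turns the joint condition at a node into one on each segment
        there.\<close>
      then have "independent_criterion (fd_label F ?u)" using indep by simp
      moreover have "\<sigma> i ! l \<in> {\<sigma> i' ! j | i' j. i' < m \<and> j < length (\<sigma> i') \<and> v i' ! j = ?u}"
        using seg[OF i] l i by auto
      ultimately have "fd_label F ?u {\<sigma> i ! l}"
        using ful[OF u] by (rule independent_criterionD)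
      then show "(Cs ! lab ?u) {\<sigma> i ! l}" using lab[OF u] by simp
    qed
    then show ?thesis
      using sub seg[OF i] i lab ws dig_start[OF i]
      by (intro fold_rest_zero[OF i, where d = n]) (auto simp: segmentation_def)
  qed
  then have "fold advance (map lab ws) start = 0" using fold_advance_0_iff[OF start_less] by simp
  then have "reach (length ws) start"
    unfolding reach_def using lab ws by (intro exI[of _ "map lab ws"]) auto
  moreover have "fd_size F = length ws + 2"
  proof -
    have "fd_nodes F = inner_nodes F \<union> {fd_source F, fd_sink F}"
      using F by (auto simp: is_flow_diagram_def inner_nodes_def)
    moreover have "card (inner_nodes F \<union> {fd_source F, fd_sink F}) = card (inner_nodes F) + 2"
      using F fin by (subst card_Un_disjoint) (auto simp: is_flow_diagram_def inner_nodes_def)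
    ultimately show ?thesis using ws distinct_card[of ws] by (simp add: fd_size_def)
  qed
  ultimately show ?thesis by blast
qed

text \<open>A letter that shortens the remainder yields one segment at its node; an idle letter
  yields none and its node is skipped, so without idle letters every node is visited. The number
  \<open>a\<close> of the first node is arbitrary because the induction drops the first
  letter.\<close>

lemma greedy_segmentation:
  assumes i: "i < m"
  shows "x \<le> n \<Longrightarrow> fold (rest i) js x = 0 \<Longrightarrow>
   \<exists>segs vs. concat segs = drop (n - x) (Ts ! i) \<and> [] \<notin> set segs \<and>
     list_all2 (\<lambda>v s. (Cs ! (js ! (v - a))) {s}) vs segs \<and>
     sorted_wrt (<) vs \<and> set vs \<subseteq> {a..<a + length js} \<and>
     (progress (rest i) js x \<longrightarrow> vs = [a..<a + length js])"
proof (induction js arbitrary: a x)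
  case Nil
  have "length (Ts ! i) = n" using i length_Ts by simp
  then show ?case using Nil by (intro exI[of _ "[]"]) auto
next
  case (Cons j js)
  let ?y = "rest i j x"
  have y: "?y \<le> x" by (rule rest_le)
  have "?y \<le> n" "fold (rest i) js ?y = 0" using Cons.prems y by auto
  from Cons.IH[OF this, of "Suc a"] obtain segs vs where
    *: "concat segs = drop (n - ?y) (Ts ! i)" "[] \<notin> set segs"
     "list_all2 (\<lambda>v s. (Cs ! (js ! (v - Suc a))) {s}) vs segs"
     "sorted_wrt (<) vs" "set vs \<subseteq> {Suc a..<Suc a + length js}"
     "progress (rest i) js ?y \<longrightarrow> vs = [Suc a..<Suc a + length js]" by auto
  have shift: "list_all2 (\<lambda>v s. (Cs ! ((j # js) ! (v - a))) {s}) vs segs"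
  proof (rule list.rel_mono_strong[OF *(3)])
    fix v s assume "v \<in> set vs" and h: "(Cs ! (js ! (v - Suc a))) {s}"
    then have "Suc a \<le> v" using *(5) by auto
    then have "v - a = Suc (v - Suc a)" by simp
    then show "(Cs ! ((j # js) ! (v - a))) {s}" using h by simp
  qed
  show ?case
  proof (cases "?y = x")
    case True
    then show ?thesis using * shift by (intro exI[of _ segs] exI[of _ vs]) auto
  next
    case False
    then have h: "?y < x" "holds i j (n - x) (n - ?y)" using rest_cases[of i j x] by auto
    let ?s = "take (n - ?y - (n - x)) (drop (n - x) (Ts ! i))"
    have l: "length (Ts ! i) = n" using i length_Ts by simp
    have "drop (n - x) (Ts ! i) = ?s @ drop (n - ?y - (n - x)) (drop (n - x) (Ts ! i))"
      by (rule append_take_drop_id[symmetric])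
    also have "drop (n - ?y - (n - x)) (drop (n - x) (Ts ! i)) = drop (n - ?y) (Ts ! i)"
      using h Cons.prems by simp
    finally have "concat (?s # segs) = drop (n - x) (Ts ! i)" using *(1) by simp
    moreover have "?s \<noteq> []" using h l Cons.prems by simp
    moreover have "[a..<a + length (j # js)] = a # [Suc a..<Suc a + length js]"
      by (simp add: upt_conv_Cons del: upt_Suc)
    ultimately show ?thesis
      using * shift h by (intro exI[of _ "?s # segs"] exI[of _ "a # vs"]) (auto simp: holds_def)
  qed
qed

text \<open>A sequence may skip nodes of the chain, hence the forward edges. For a single sequence they are
  not needed, and writing them would take quadratic time.\<close>

definition chain_edges :: "nat \<Rightarrow> (nat \<times> nat) set" where
  "chain_edges l = {(u, v). u < v \<and> v \<le> l \<and> (m < 2 \<longrightarrow> v = Suc u)}"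

text \<open>The converse of \<open>valid_diagram_reach\<close> for words without idle letters.
  Labels are shifted by one because node \<open>0\<close> is the source.\<close>

lemma chain_diagram_valid:
  assumes js: "set js \<subseteq> {..<k}" "fold advance js start = 0" "progress advance js start"
    and F: "fd_nodes F = {..length js + 1}" "fd_edges F = chain_edges (length js + 1)"
      "fd_source F = 0" "fd_sink F = length js + 1"
      "\<And>v. v \<in> {1..length js} \<Longrightarrow> fd_label F v = Cs ! (js ! (v - 1))"
  shows "is_flow_diagram (set Cs) F \<and> valid_for Ts F"
proof
  let ?l = "length js + 1"
  have inner: "inner_nodes F = {1..length js}" using F by (auto simp: inner_nodes_def)
  have "acyclic (fd_edges F)"
    by (rule acyclic_subset[of less_than])
      (auto simp: F chain_edges_def wf_acyclic)
  moreover have labels: "Cs ! (js ! (v - 1)) \<in> set Cs" if "v \<in> {1..length js}" for v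
  proof -
    have "js ! (v - 1) \<in> set js" using that by auto
    then show ?thesis using js(1) by auto
  qed
  ultimately show "is_flow_diagram (set Cs) F"
    using F(1-4) labels unfolding is_flow_diagram_def inner
    by (auto simp: F(5) chain_edges_def)
  have "\<exists>segs vs. concat segs = Ts ! i \<and> [] \<notin> set segs \<and>
     list_all2 (\<lambda>v s. (Cs ! (js ! (v - 1))) {s}) vs segs \<and> set vs \<subseteq> {1..length js} \<and>
     successively (\<lambda>x y. (x, y) \<in> fd_edges F) (0 # vs @ [?l])" if i: "i < m" for i
  proof -
    have "fold (rest i) js n = 0"
      using js(2) fold_advance_0_iff[OF start_less] dig_start i by metis
    from greedy_segmentation[OF i _ this, of 1] obtain segs vs where
      *: "concat segs = Ts ! i" "[] \<notin> set segs"
        "list_all2 (\<lambda>v s. (Cs ! (js ! (v - 1))) {s}) vs segs"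
        "sorted_wrt (<) vs" "set vs \<subseteq> {1..<1 + length js}"
        "progress (rest i) js n \<longrightarrow> vs = [1..<1 + length js]" by auto
    have "successively (\<lambda>x y. (x, y) \<in> fd_edges F) (0 # vs @ [?l])"
    proof (cases "m < 2")
      case True
      then have m: "m = 1" using i by simp
      \<comment> \<open>The code of a single sequence is its remaining length, so its path visits
        every node and consecutive edges suffice.\<close>
      then have "progress (rest 0) js n"
        using progress_single[of n js] js(3) by (simp add: start_def)
      then have "vs = [1..<1 + length js]" using * i m by simp
      then have eq: "0 # vs @ [?l] = [0..<Suc ?l]"
        by (metis One_nat_def Suc_eq_plus1_left append_Cons upt_Suc_append upt_conv_Cons zero_le
            zero_less_Suc add.commute)
      show ?thesis unfolding eq F(2) successively_conv_nth
        by (auto simp: chain_edges_def nth_append simp del: upt_Suc)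
    next
      case False
      have "sorted_wrt (<) (0 # vs @ [?l])" using *(4,5) by (auto simp: sorted_wrt_append)
      then have "successively (<) (0 # vs @ [?l])" 
        by (subst successively_iff_sorted_wrt_strong) auto
      then show ?thesis
        by (rule successively_mono) (use False *(5) in \<open>auto simp: F(2) chain_edges_def\<close>)
    qed
    then show ?thesis using * by (intro exI[of _ segs] exI[of _ vs]) auto
  qed
  then obtain \<sigma> v where
    sv: "\<And>i. i < m \<Longrightarrow> concat (\<sigma> i) = Ts ! i \<and> [] \<notin> set (\<sigma> i) \<and>
     list_all2 (\<lambda>v s. (Cs ! (js ! (v - 1))) {s}) (v i) (\<sigma> i) \<and> set (v i) \<subseteq> {1..length js} \<and>
     successively (\<lambda>x y. (x, y) \<in> fd_edges F) (0 # v i @ [?l])" by metis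
  show "valid_for Ts F"
    unfolding valid_for_def
  proof (rule exI[of _ \<sigma>], rule exI[of _ v], intro conjI allI ballI impI)
    fix i assume "i < m"
    note sv = sv[OF this]
    show "segmentation (Ts ! i) (\<sigma> i)" using sv by (simp add: segmentation_def)
    show "length (v i) = length (\<sigma> i)" using sv by (auto dest: list_all2_lengthD)
    show "successively (\<lambda>x y. (x, y) \<in> fd_edges F) (fd_source F # v i @ [fd_sink F])"
      using sv F by simp
  next
    fix u assume u: "u \<in> inner_nodes F"
    have lab: "fd_label F u = Cs ! (js ! (u - 1))" "Cs ! (js ! (u - 1)) \<in> set Cs"
      using u inner labels F(5) by auto
    have "independent_criterion (fd_label F u)" using indep lab by simp
    moreover have "fd_label F u {s}" if "s \<in> {\<sigma> i ! j | i j. i < m \<and> j < length (\<sigma> i) \<and> v i ! j = u}" for s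
      using that sv lab(1) by (auto simp: list_all2_conv_all_nth)
    ultimately show "fd_label F u {\<sigma> i ! j | i j. i < m \<and> j < length (\<sigma> i) \<and> v i ! j = u}"
      by (rule independent_criterionI)
  qed
qed

end

section \<open>A Hoare logic with running times\<close>

text \<open>Total correctness. Asking for an execution also rules out ill-formed oracle queries,
  since these block execution.\<close>

definition triple ::
  "oracle_fun \<Rightarrow> (state \<Rightarrow> bool) \<Rightarrow> com \<Rightarrow> nat \<Rightarrow> (state \<Rightarrow> bool) \<Rightarrow> bool" where
  "triple \<Omega> P c t Q \<longleftrightarrow> (\<forall>s. P s \<longrightarrow> (\<exists>t' s'. exec \<Omega> c s t' s' \<and> t' \<le> t \<and> Q s'))"

lemma triple_Sequ:
  assumes "triple \<Omega> P c t R" "triple \<Omega> R d u Q"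
  shows "triple \<Omega> P (Sequ c d) (t + u) Q"
  unfolding triple_def
proof (intro allI impI)
  fix s assume "P s"
  then obtain t' s' where 1: "exec \<Omega> c s t' s'" "t' \<le> t" "R s'"
    using assms(1) unfolding triple_def by blast
  then obtain u' s'' where 2: "exec \<Omega> d s' u' s''" "u' \<le> u" "Q s''"
    using assms(2) unfolding triple_def by blast
  from 1 2 exec.Sequ[OF 1(1) 2(1)] show "\<exists>t' s'. exec \<Omega> (Sequ c d) s t' s' \<and> t' \<le> t + u \<and> Q s'"
    by (metis add_mono)
qed

lemma triple_conseq:
  assumes "triple \<Omega> P' c t' Q'" "\<And>s. P s \<Longrightarrow> P' s" "t' \<le> t" "\<And>s. Q' s \<Longrightarrow> Q s"
  shows "triple \<Omega> P c t Q"
  using assms unfolding triple_def by (meson order.trans)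

lemma triple_Cond:
  assumes "triple \<Omega> (\<lambda>s. P s \<and> bval b s) c t Q" "triple \<Omega> (\<lambda>s. P s \<and> \<not> bval b s) d t Q"
  shows "triple \<Omega> P (Cond b c d) (1 + bcost b + t) Q"
  unfolding triple_def
proof (intro allI impI)
  fix s assume P: "P s"
  show "\<exists>t' s'. exec \<Omega> (Cond b c d) s t' s' \<and> t' \<le> 1 + bcost b + t \<and> Q s'"
  proof (cases "bval b s")
    case True
    then obtain t' s' where "exec \<Omega> c s t' s'" "t' \<le> t" "Q s'"
      using assms(1) P unfolding triple_def by blast
    then show ?thesis using exec.Cond_True[OF True] by (meson add_le_cancel_left)
  next
    case False
    then obtain t' s' where "exec \<Omega> d s t' s'" "t' \<le> t" "Q s'"
      using assms(2) P unfolding triple_def by blast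
    then show ?thesis using exec.Cond_False[OF False] by (meson add_le_cancel_left)
  qed
qed

text \<open>The variant \<open>v\<close> also bounds the number of iterations left; it may drop by
  more than one at a time.\<close>

lemma triple_While:
  assumes "\<And>v. triple \<Omega> (\<lambda>s. I v s \<and> bval b s) c t (\<lambda>s. \<exists>v'<v. I v' s)"
  shows "triple \<Omega> (I v) (Loop b c) (v * (1 + bcost b + t) + (1 + bcost b)) (\<lambda>s. (\<exists>v'. I v' s) \<and> \<not> bval b s)"
proof (induction v rule: less_induct)
  case (less v)
  show ?case unfolding triple_def
  proof (intro allI impI)
    fix s assume I: "I v s"
    show "\<exists>t' s'. exec \<Omega> (Loop b c) s t' s' \<and> t' \<le> v * (1 + bcost b + t) + (1 + bcost b) \<and>
      ((\<exists>v'. I v' s') \<and> \<not> bval b s')"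
    proof (cases "bval b s")
      case False
      then show ?thesis using I exec.Loop_False[OF False] by (meson le_add2)
    next
      case True
      then obtain t1 s1 v1 where 1: "exec \<Omega> c s t1 s1" "t1 \<le> t" "v1 < v" "I v1 s1"
        using assms[of v] I unfolding triple_def by blast
      then obtain t2 s2 where 2: "exec \<Omega> (Loop b c) s1 t2 s2"
        "t2 \<le> v1 * (1 + bcost b + t) + (1 + bcost b)" "\<exists>v'. I v' s2" "\<not> bval b s2"
        using less[OF 1(3)] unfolding triple_def by blast
      have "Suc v1 * (1 + bcost b + t) \<le> v * (1 + bcost b + t)"
        using 1(3) by (intro mult_right_mono) auto
      then have "1 + bcost b + t1 + t2 \<le> v * (1 + bcost b + t) + (1 + bcost b)"
        using 1(2) 2(2) by simp
      then show ?thesis using exec.Loop_True[OF True 1(1) 2(1)] 2(3,4) by blast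
    qed
  qed
qed

text \<open>Iterations may differ in cost, which is what allows the geometrically growing layers to
  be summed.\<close>

lemma triple_For:
  assumes step: "\<And>l. l < N \<Longrightarrow> triple \<Omega> (I l) c (t l) (I (Suc l))"
    and guard: "\<And>l s. l \<le> N \<Longrightarrow> I l s \<Longrightarrow> bval b s \<longleftrightarrow> l < N"
  shows "triple \<Omega> (I 0) (Loop b c) ((\<Sum>l<N. 1 + bcost b + t l) + (1 + bcost b)) (I N)"
proof -
  have "triple \<Omega> (I (N - M)) (Loop b c) ((\<Sum>l\<in>{N - M..<N}. 1 + bcost b + t l) + (1 + bcost b)) (I N)"
    if "M \<le> N" for M
    using that
  proof (induction M)
    case 0
    show ?case unfolding triple_def
    proof (intro allI impI)
      fix s assume "I (N - 0) s"
      moreover from this have "\<not> bval b s" using guard[of N s] by simp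
      ultimately show "\<exists>t' s'. exec \<Omega> (Loop b c) s t' s' \<and>
          t' \<le> (\<Sum>l = N - 0..<N. 1 + bcost b + t l) + (1 + bcost b) \<and> I N s'"
        using exec.Loop_False by (metis diff_zero le_add2)
    qed
  next
    case (Suc M)
    let ?l = "N - Suc M"
    have l: "?l < N" "Suc ?l = N - M" using Suc.prems by auto
    have sum: "(\<Sum>l\<in>{?l..<N}. 1 + bcost b + t l) = 1 + bcost b + t ?l + (\<Sum>l\<in>{N - M..<N}. 1 + bcost b + t l)"
      using l by (metis sum.atLeast_Suc_lessThan)
    show ?case unfolding triple_def
    proof (intro allI impI)
      fix s assume I: "I ?l s"
      then have b: "bval b s" using guard[of ?l s] l by simp
      obtain t1 s1 where 1: "exec \<Omega> c s t1 s1" "t1 \<le> t ?l" "I (N - M) s1"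
        using step[OF l(1)] I l(2) unfolding triple_def by metis
      then obtain t2 s2 where 2: "exec \<Omega> (Loop b c) s1 t2 s2"
        "t2 \<le> (\<Sum>l\<in>{N - M..<N}. 1 + bcost b + t l) + (1 + bcost b)" "I N s2"
        using Suc unfolding triple_def by (meson Suc_leD)
      have "1 + bcost b + t1 + t2 \<le> (\<Sum>l\<in>{?l..<N}. 1 + bcost b + t l) + (1 + bcost b)"
        unfolding sum using 1(2) 2(2) by simp
      then show "\<exists>t' s'. exec \<Omega> (Loop b c) s t' s' \<and>
          t' \<le> (\<Sum>l\<in>{?l..<N}. 1 + bcost b + t l) + (1 + bcost b) \<and> I N s'"
        using exec.Loop_True[OF b 1(1) 2(1)] 2(3) by blast
    qed
  qed
  from this[of N] show ?thesis by (simp add: atLeast0LessThan)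
qed

lemma triple_For_const:
  assumes "\<And>l. l < N \<Longrightarrow> triple \<Omega> (I l) c t (I (Suc l))"
    and "\<And>l s. l \<le> N \<Longrightarrow> I l s \<Longrightarrow> bval b s \<longleftrightarrow> l < N"
  shows "triple \<Omega> (I 0) (Loop b c) (N * (1 + bcost b + t) + (1 + bcost b)) (I N)"
  using triple_For[of N \<Omega> I c "\<lambda>_. t" b] assms by simp

section \<open>Straight-line programs: effect and worst-case cost\<close>

fun straight :: "com \<Rightarrow> bool" where
  "straight (Check x i j a b) \<longleftrightarrow> False"
| "straight (Loop b p) \<longleftrightarrow> False"
| "straight (Sequ p q) \<longleftrightarrow> straight p \<and> straight q"
| "straight (Cond b p q) \<longleftrightarrow> straight p \<and> straight q"
| "straight _ \<longleftrightarrow> True"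

fun run :: "com \<Rightarrow> state \<Rightarrow> state" where
  "run (Assign x e) s = set_var x (aval e s) s"
| "run (Put A e f) s = set_cell A (aval e s) (aval f s) s"
| "run (Sequ p q) s = run q (run p s)"
| "run (Cond b p q) s = (if bval b s then run p s else run q s)"
| "run _ s = s"

text \<open>Charging a conditional for both branches makes the bound independent of the
  state.\<close>

fun cost :: "com \<Rightarrow> nat" where
  "cost (Assign x e) = 1 + acost e"
| "cost (Put A e f) = 1 + acost e + acost f"
| "cost (Sequ p q) = cost p + cost q"
| "cost (Cond b p q) = 1 + bcost b + (cost p + cost q)"
| "cost _ = 1"

lemma exec_run: "straight c \<Longrightarrow> \<exists>t\<le>cost c. exec \<Omega> c s t (run c s)"
proof (induction c arbitrary: s)
  case (Sequ c d)
  then obtain t u where "t \<le> cost c" "exec \<Omega> c s t (run c s)" "u \<le> cost d"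
    "exec \<Omega> d (run c s) u (run d (run c s))" by (metis straight.simps(3))
  then show ?case by (intro exI[of _ "t + u"]) (auto intro: exec.Sequ)
next
  case (Cond b c d)
  show ?case
  proof (cases "bval b s")
    case True
    from Cond.IH(1)[of s] Cond.prems obtain t where "t \<le> cost c" "exec \<Omega> c s t (run c s)" by auto
    then show ?thesis using True by (intro exI[of _ "1 + bcost b + t"]) (auto intro: exec.Cond_True[simplified])
  next
    case False
    from Cond.IH(2)[of s] Cond.prems obtain t where "t \<le> cost d" "exec \<Omega> d s t (run d s)" by auto
    then show ?thesis using False by (intro exI[of _ "1 + bcost b + t"]) (auto intro: exec.Cond_False[simplified])
  qed
qed (auto intro: exec.intros[simplified])

lemma triple_straight:
  assumes "straight c" "cost c \<le> t" "\<And>s. P s \<Longrightarrow> Q (run c s)"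
  shows "triple \<Omega> P c t Q"
  using assms exec_run[OF assms(1)] unfolding triple_def by (meson order.trans)

lemma fst_set_var [simp]: "fst (set_var x a s) = (fst s)(x := a)"
  and snd_set_var [simp]: "snd (set_var x a s) = snd s"
  and fst_set_cell [simp]: "fst (set_cell A i a s) = fst s"
  and snd_set_cell [simp]: "snd (set_cell A i a s) = (snd s)(A := (snd s A)(i := a))"
  by (simp_all add: set_var_def set_cell_def)

section \<open>The program\<close>

notation Sequ (infixr ";;" 60)

definition incr :: "name \<Rightarrow> com" where
  "incr x = Assign x (Add (Var x) (Num 1))"

text \<open>Registers: \<open>p = (n + 1) ^ i\<close> and \<open>v = e * p\<close>, where \<open>e\<close> is the current candidate for
  \<open>rest i j d\<close>; \<open>G\<close> stores \<open>rest i j d * p\<close> at \<open>d * k + j\<close>.\<close>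

definition scan_step :: com where
  "scan_step =
     Assign ''x'' (Num 1) ;;
     Cond (Lt (Var ''e'') (Var ''d''))
       (Check ''x'' (Var ''i'') (Var ''j'') (Sub (Var ''n'') (Var ''d'')) (Sub (Var ''n'') (Var ''e'')))
       Skip ;;
     Cond (Lt (Num 0) (Var ''x''))
       (Put ''G'' (Var ''g'') (Var ''v'') ;; Assign ''g'' (Add (Var ''g'') (Var ''k'')) ;; incr ''d'')
       (incr ''e'' ;; Assign ''v'' (Add (Var ''v'') (Var ''p'')))"

definition scan :: com where
  "scan =
     (Assign ''d'' (Num 1) ;; Assign ''e'' (Num 0) ;; Assign ''v'' (Num 0) ;;
      Assign ''g'' (Add (Var ''k'') (Var ''j''))) ;;
     Loop (Neg (Lt (Var ''n'') (Var ''d''))) scan_step ;;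
     incr ''j''"

text \<open>\<open>S\<close> stores the \<open>j\<close>-th successor of \<open>q = d * p + r\<close> at \<open>w = q * k + j\<close>. A criterion without
  progress at \<open>q\<close> is discarded because the cell \<open>D q\<close> read for it still contains \<open>0\<close>.\<close>

definition entry :: com where
  "entry =
     Assign ''z'' (Add (Get ''S'' (Var ''u'')) (Get ''G'' (Add (Var ''g'') (Var ''j'')))) ;;
     Put ''S'' (Var ''w'') (Var ''z'') ;;
     Assign ''y'' (Get ''D'' (Var ''z'')) ;;
     Cond (Conj (Lt (Num 0) (Var ''y'')) (Neg (Conj (Lt (Num 0) (Var ''b'')) (Neg (Lt (Var ''y'') (Var ''b''))))))
       (Assign ''b'' (Var ''y'') ;; Put ''L'' (Var ''q'') (Var ''j'') ;; Put ''X'' (Var ''q'') (Var ''z''))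
       Skip ;;
     incr ''j'' ;; incr ''u'' ;; incr ''w''"

definition row :: com where
  "row =
     (Assign ''b'' (Num 0) ;; Assign ''j'' (Num 0)) ;;
     Loop (Lt (Var ''j'') (Var ''k'')) entry ;;
     Cond (Lt (Num 0) (Var ''b'')) (Put ''D'' (Var ''q'') (Add (Var ''b'') (Num 1))) Skip ;;
     incr ''q'' ;; incr ''r''"

definition block :: com where
  "block =
     (Assign ''r'' (Num 0) ;; Assign ''u'' (Num 0)) ;;
     Loop (Lt (Var ''r'') (Var ''p'')) row ;;
     incr ''d'' ;; Assign ''g'' (Add (Var ''g'') (Var ''k''))"

text \<open>Layer \<open>i\<close> treats the codes from \<open>(n + 1) ^ i\<close> up to
  \<open>(n + 1) ^ (i + 1) - 1\<close> by leading digit \<open>d\<close> and then by lower part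
  \<open>r\<close>; thus \<open>q\<close> counts upwards through all layers.\<close>

definition layer :: com where
  "layer =
     Assign ''j'' (Num 0) ;;
     Loop (Lt (Var ''j'') (Var ''k'')) scan ;;
     (Assign ''d'' (Num 1) ;; Assign ''g'' (Var ''k'')) ;;
     Loop (Neg (Lt (Var ''n'') (Var ''d''))) block ;;
     Assign ''p'' (Var ''q'') ;; incr ''i''"

text \<open>For \<open>n = 0\<close> the layers are skipped, since \<open>k * m\<close> steps would exceed the time bound.\<close>

definition fill :: com where
  "fill =
     (Assign ''p'' (Num 1) ;; Assign ''q'' (Num 1) ;; Assign ''w'' (Var ''k'') ;; Put ''D'' (Num 0) (Num 1)) ;;
     Loop (Conj (Lt (Num 0) (Var ''n'')) (Lt (Var ''i'') (Var ''m''))) layer"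

definition walk_step :: com where
  "walk_step =
     Put ''label'' (Var ''v'') (Get ''L'' (Var ''q'')) ;; Assign ''q'' (Get ''X'' (Var ''q'')) ;; incr ''v''"

definition edge :: com where
  "edge =
     Put ''tail'' (Var ''e'') (Var ''u'') ;; Put ''head'' (Var ''e'') (Var ''v'') ;; incr ''e'' ;; incr ''u''"

definition edge_row :: com where
  "edge_row =
     Cond (Lt (Var ''m'') (Num 2)) (Assign ''u'' (Sub (Var ''v'') (Num 1))) (Assign ''u'' (Num 0)) ;;
     Loop (Lt (Var ''u'') (Var ''v'')) edge ;;
     incr ''v''"

definition emit :: com where
  "emit =
     (Assign ''found'' (Num 1) ;; Assign ''l'' (Get ''D'' (Sub (Var ''p'') (Num 1))) ;;
      Assign ''nodes'' (Add (Var ''l'') (Num 1)) ;; Assign ''sink'' (Var ''l'') ;; Assign ''source'' (Num 0) ;;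
      Assign ''q'' (Sub (Var ''p'') (Num 1)) ;; Assign ''v'' (Num 1)) ;;
     Loop (Lt (Var ''v'') (Var ''l'')) walk_step ;;
     (Assign ''v'' (Num 1) ;; Assign ''e'' (Num 0)) ;;
     Loop (Neg (Lt (Var ''l'') (Var ''v''))) edge_row ;;
     Assign ''edges'' (Var ''e'')"

text \<open>After \<open>fill\<close> the register \<open>p\<close> holds
  \<open>(n + 1) ^ m\<close>, so \<open>p - 1\<close> is the code \<open>start\<close>.\<close>

definition program :: com where
  "program = fill ;; Cond (Lt (Num 0) (Get ''D'' (Sub (Var ''p'') (Num 1)))) emit Skip"

text \<open>Row-major addressing is injective, so writing one table cell preserves the
  others.\<close>

lemma index_eq_iff:
  fixes k :: nat
  assumes "j < k" "j' < k"
  shows "d * k + j = d' * k + j' \<longleftrightarrow> d = d' \<and> j = j'"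
proof
  assume eq: "d * k + j = d' * k + j'"
  have "(d * k + j) div k = d" "(d * k + j) mod k = j" "(d' * k + j') div k = d'" "(d' * k + j') mod k = j'"
    using assms by simp_all
  then show "d = d' \<and> j = j'" using eq by metis
qed simp

section \<open>Correctness and running time\<close>

locale flow_run = flow_instance +
  fixes \<theta> :: "'a criterion \<Rightarrow> 'a list \<Rightarrow> nat" and T :: nat
  assumes check_time: "\<And>C \<sigma>. C \<in> set Cs \<Longrightarrow> length \<sigma> \<le> n \<Longrightarrow> \<theta> C \<sigma> \<le> T"
begin

abbreviation "\<Omega> \<equiv> check_oracle Ts Cs \<theta>"

lemma check_oracle_holds:
  assumes "i < m" "j < k" "a < b" "b \<le> n"
  shows "\<exists>t\<le>T. \<Omega> i j a b = Some (holds i j a b, t)"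
proof -
  have "length (Ts ! i) = n" using assms length_Ts by simp
  then show ?thesis using assms check_time[of "Cs ! j"]
    by (auto simp: check_oracle_def holds_def Let_def)
qed

section \<open>Contents of the tables as the sweep advances\<close>

definition stab :: "nat \<Rightarrow> nat \<Rightarrow> (nat \<Rightarrow> nat) \<Rightarrow> bool" where
  "stab q j S \<longleftrightarrow> (\<forall>q'\<le>q. \<forall>j'<k. q' < q \<or> j' < j \<longrightarrow> S (q' * k + j') = advance j' q')"

lemma stab_update: "stab q j S \<Longrightarrow> j < k \<Longrightarrow> stab q (Suc j) (S(q * k + j := advance j q))"
  unfolding stab_def by (auto simp: index_eq_iff less_Suc_eq)

lemma stab_next: "stab q k S \<Longrightarrow> stab (Suc q) 0 S"
  unfolding stab_def by (auto simp: le_Suc_eq)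

text \<open>Fresh memory is already correct for the code \<open>0\<close>, which is its own
  successor.\<close>

lemma stab_start: "stab 1 0 (\<lambda>_. 0)"
  unfolding stab_def by (auto simp: advance_0)

text \<open>The table is filled one criterion after the other, so \<open>j\<close> is the major
  index; rows begin at \<open>1\<close> because leading digits are positive.\<close>

definition gtab :: "nat \<Rightarrow> nat \<Rightarrow> nat \<Rightarrow> (nat \<Rightarrow> nat) \<Rightarrow> bool" where
  "gtab i j d G \<longleftrightarrow> (\<forall>j'\<le>j. \<forall>d'\<in>{1..n}. j' < k \<and> (j' < j \<or> d' < d) \<longrightarrow> G (d' * k + j') = rest i j' d' * B ^ i)"

lemma gtab_update:
  "gtab i j d G \<Longrightarrow> j < k \<Longrightarrow> gtab i j (Suc d) (G(d * k + j := rest i j d * B ^ i))"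
  unfolding gtab_def by (auto simp: index_eq_iff less_Suc_eq)

lemma gtab_next: "gtab i j (Suc n) G \<Longrightarrow> gtab i (Suc j) 1 G"
  unfolding gtab_def by (auto simp: le_Suc_eq)

lemma gtab_start: "gtab i 0 (Suc 0) G"
  unfolding gtab_def by auto

text \<open>A running minimum over the letters below \<open>j\<close>, with \<open>b = 0\<close> for
  none found yet; only a positive \<open>b\<close> gives the pointers at \<open>q\<close> a
  meaning.\<close>

definition best :: "nat \<Rightarrow> nat \<Rightarrow> nat \<Rightarrow> (nat \<Rightarrow> nat) \<Rightarrow> (nat \<Rightarrow> nat) \<Rightarrow> bool" where
  "best q j b L X \<longleftrightarrow>
     (\<forall>j'<j. 0 < opt_below q (advance j' q) \<longrightarrow> 0 < b \<and> b \<le> opt_below q (advance j' q)) \<and>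
     (0 < b \<longrightarrow> L q < j \<and> X q = advance (L q) q \<and> opt_below q (X q) = b)"

lemma best_start: "best q 0 0 L X"
  unfolding best_def by simp

lemma best_better:
  "best q j b L X \<Longrightarrow> y = opt_below q (advance j q) \<Longrightarrow> 0 < y \<Longrightarrow> \<not> (0 < b \<and> \<not> y < b) \<Longrightarrow>
    best q (Suc j) y (L(q := j)) (X(q := advance j q))"
  unfolding best_def by (auto simp: less_Suc_eq)

lemma best_worse:
  "best q j b L X \<Longrightarrow> y = opt_below q (advance j q) \<Longrightarrow> \<not> (0 < y \<and> \<not> (0 < b \<and> \<not> y < b)) \<Longrightarrow>
    best q (Suc j) b L X"
  unfolding best_def by (auto simp: less_Suc_eq)

lemma linked_update: "linked q L X \<Longrightarrow> linked q (L(q := a)) (X(q := b))"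
  unfolding linked_def by auto

lemma best_final:
  assumes "best q k b L X" "0 < q" "q < B ^ m"
  shows "opt q = (if 0 < b then Suc b else 0)"
  using assms opt_eq_best[of q b "L q"] unfolding best_def by auto

text \<open>A positive \<open>b\<close> forces \<open>X q < q\<close>, since
  \<open>opt_below\<close> vanishes from \<open>q\<close> on; hence \<open>b\<close> is the true
  \<open>opt\<close> of the successor.\<close>

lemma linked_Suc:
  assumes "linked q L X" "best q k b L X" "0 < q" "q < B ^ m"
  shows "linked (Suc q) L X"
  using assms(1,2) best_final[OF assms(2-4)] unfolding linked_def best_def
  by (auto simp: less_Suc_eq opt_below_def split: if_splits)

definition base :: "nat \<Rightarrow> nat \<Rightarrow> state \<Rightarrow> bool" where
  "base i q s \<longleftrightarrow> fst s ''m'' = m \<and> fst s ''n'' = n \<and> fst s ''k'' = k \<and> fst s ''found'' = 0 \<and>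
     fst s ''i'' = i \<and> fst s ''p'' = B ^ i \<and> fst s ''q'' = q \<and>
     snd s ''D'' = opt_below q \<and> linked q (snd s ''L'') (snd s ''X'')"

text \<open>When \<open>d\<close> grows, \<open>e\<close> stays a lower bound for the value sought
  and is never reset. So each step advances one of the two pointers, and the variant
  \<open>c\<close> starts at \<open>2 * n\<close> from \<open>d = 1\<close> and
  \<open>e = 0\<close>.\<close>

definition scan_inv :: "nat \<Rightarrow> nat \<Rightarrow> nat \<Rightarrow> state \<Rightarrow> bool" where
  "scan_inv i j c s \<longleftrightarrow> (let d = fst s ''d''; e = fst s ''e'' in
     base i (B ^ i) s \<and> fst s ''w'' = B ^ i * k \<and> stab (B ^ i) 0 (snd s ''S'') \<and>
     fst s ''j'' = j \<and> 1 \<le> d \<and> d \<le> Suc n \<and> e \<le> d \<and> (d \<le> n \<longrightarrow> e \<le> rest i j d) \<and>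
     fst s ''v'' = e * B ^ i \<and> fst s ''g'' = d * k + j \<and> gtab i j d (snd s ''G'') \<and>
     c + d + e = Suc (2 * n))"

text \<open>As \<open>e\<close> is at most \<open>rest i j d\<close>, a positive check identifies
  the two. For \<open>e = d\<close> the segment would be empty and the query ill-formed; the default
  \<open>1\<close> of \<open>x\<close> then accepts \<open>d\<close> itself.\<close>

lemma scan_step_triple:
  assumes "i < m" "j < k"
  shows "triple \<Omega> (\<lambda>s. scan_inv i j c s \<and> bval (Neg (Lt (Var ''n'') (Var ''d''))) s) scan_step (T + 50)
     (\<lambda>s. \<exists>c'<c. scan_inv i j c' s)"
proof -
  let ?I = "\<lambda>s. scan_inv i j c s \<and> fst s ''d'' \<le> n"
  let ?H = "\<lambda>s. fst s ''e'' = rest i j (fst s ''d'')"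
  have check: "triple \<Omega> (\<lambda>s. (?I s \<and> fst s ''x'' = 1) \<and> bval (Lt (Var ''e'') (Var ''d'')) s)
    (Check ''x'' (Var ''i'') (Var ''j'') (Sub (Var ''n'') (Var ''d'')) (Sub (Var ''n'') (Var ''e''))) (T + 9)
    (\<lambda>s. ?I s \<and> fst s ''x'' = of_bool (?H s))"
    unfolding triple_def
  proof (intro allI impI)
    fix s assume s: "(?I s \<and> fst s ''x'' = 1) \<and> bval (Lt (Var ''e'') (Var ''d'')) s"
    let ?d = "fst s ''d''" and ?e = "fst s ''e''"
    have v: "fst s ''i'' = i" "fst s ''j'' = j" "fst s ''n'' = n" "?d \<le> n" "?e < ?d" "?e \<le> rest i j ?d"
      using s by (auto simp: scan_inv_def base_def Let_def)
    have "n - ?d < n - ?e" using v by linarith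
    then obtain t where t: "t \<le> T" "\<Omega> i j (n - ?d) (n - ?e) = Some (holds i j (n - ?d) (n - ?e), t)"
      using check_oracle_holds[OF assms, of "n - ?d" "n - ?e"] by auto
    have h: "holds i j (n - ?d) (n - ?e) \<longleftrightarrow> ?e = rest i j ?d"
    proof
      assume "holds i j (n - ?d) (n - ?e)"
      then show "?e = rest i j ?d" using rest_least[OF v(5)] v(6) by (metis le_antisym)
    next
      assume "?e = rest i j ?d"
      then show "holds i j (n - ?d) (n - ?e)" using rest_cases[of i j ?d] v(5) by (metis less_irrefl)
    qed
    have "exec \<Omega> (Check ''x'' (Var ''i'') (Var ''j'') (Sub (Var ''n'') (Var ''d'')) (Sub (Var ''n'') (Var ''e'')))
      s (1 + acost (Var ''i'') + acost (Var ''j'') + acost (Sub (Var ''n'') (Var ''d'')) +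
         acost (Sub (Var ''n'') (Var ''e'')) + t) (set_var ''x'' (of_bool (holds i j (n - ?d) (n - ?e))) s)"
      by (rule exec.Check) (simp add: v t)
    moreover have "1 + acost (Var ''i'') + acost (Var ''j'') + acost (Sub (Var ''n'') (Var ''d'')) +
         acost (Sub (Var ''n'') (Var ''e'')) + t \<le> T + 9" using t by simp
    moreover have "?I (set_var ''x'' (of_bool (holds i j (n - ?d) (n - ?e))) s)"
      using s by (simp add: scan_inv_def base_def)
    ultimately show "\<exists>t' s'. exec \<Omega> (Check ''x'' (Var ''i'') (Var ''j'')
      (Sub (Var ''n'') (Var ''d'')) (Sub (Var ''n'') (Var ''e''))) s t' s' \<and> t' \<le> T + 9 \<and>
      ?I s' \<and> fst s' ''x'' = of_bool (?H s')" using h by fastforce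
  qed
  have no_check: "triple \<Omega> (\<lambda>s. (?I s \<and> fst s ''x'' = 1) \<and> \<not> bval (Lt (Var ''e'') (Var ''d'')) s)
    Skip (T + 9) (\<lambda>s. ?I s \<and> fst s ''x'' = of_bool (?H s))"
  proof (rule triple_straight)
    fix s assume s: "(?I s \<and> fst s ''x'' = 1) \<and> \<not> bval (Lt (Var ''e'') (Var ''d'')) s"
    have "?H s" using s rest_le[of i j "fst s ''d''"] by (auto simp: scan_inv_def Let_def)
    then show "?I (run Skip s) \<and> fst (run Skip s) ''x'' = of_bool (?H (run Skip s))" using s by simp
  qed simp_all
  have pre: "triple \<Omega> ?I (Assign ''x'' (Num 1)) 2 (\<lambda>s. ?I s \<and> fst s ''x'' = 1)"
    by (rule triple_straight) (simp_all add: scan_inv_def base_def)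
  have post: "triple \<Omega> (\<lambda>s. ?I s \<and> fst s ''x'' = of_bool (?H s))
    (Cond (Lt (Num 0) (Var ''x''))
       (Put ''G'' (Var ''g'') (Var ''v'') ;; Assign ''g'' (Add (Var ''g'') (Var ''k'')) ;; incr ''d'')
       (incr ''e'' ;; Assign ''v'' (Add (Var ''v'') (Var ''p'')))) 30 (\<lambda>s. \<exists>c'<c. scan_inv i j c' s)"
    (is "triple _ _ ?c _ _")
  proof (rule triple_straight)
    fix s assume s: "?I s \<and> fst s ''x'' = of_bool (?H s)"
    let ?d = "fst s ''d''" and ?e = "fst s ''e''"
    have c: "c > 0" using s by (auto simp: scan_inv_def Let_def)
    have "scan_inv i j (c - 1) (run ?c s)"
    proof (cases "?H s")
      case True
      \<comment> \<open>By monotonicity the value found for \<open>d\<close> is a lower bound for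
        the next one.\<close>
      have "?e \<le> rest i j (Suc ?d)" if "Suc ?d \<le> n" 
        using rest_mono[OF assms, of ?d "Suc ?d"] that True by simp
      moreover have "gtab i j (Suc ?d) ((snd s ''G'')(?d * k + j := ?e * B ^ i))"
        using s True gtab_update[of i j ?d "snd s ''G''"] assms by (simp add: scan_inv_def Let_def)
      ultimately show ?thesis using s True c
        by (auto simp: scan_inv_def base_def Let_def incr_def)
    next
      case False
      then have "?e < rest i j ?d" using s by (auto simp: scan_inv_def Let_def)
      moreover have "rest i j ?d \<le> ?d" by (rule rest_le)
      ultimately show ?thesis using s False c
        by (auto simp: scan_inv_def base_def Let_def incr_def)
    qed
    then show "\<exists>c'<c. scan_inv i j c' (run ?c s)" using c by (meson diff_less zero_less_one)
  qed (simp_all add: incr_def)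
  have mid: "triple \<Omega> (\<lambda>s. ?I s \<and> fst s ''x'' = 1) (Cond (Lt (Var ''e'') (Var ''d''))
       (Check ''x'' (Var ''i'') (Var ''j'') (Sub (Var ''n'') (Var ''d'')) (Sub (Var ''n'') (Var ''e'')))
       Skip) (1 + bcost (Lt (Var ''e'') (Var ''d'')) + (T + 9)) (\<lambda>s. ?I s \<and> fst s ''x'' = of_bool (?H s))"
    by (rule triple_Cond[OF check no_check])
  show ?thesis unfolding scan_step_def
    by (rule triple_conseq[OF triple_Sequ[OF pre triple_Sequ[OF mid post]]])
      (auto simp: scan_inv_def base_def Let_def)
qed


definition scanned :: "nat \<Rightarrow> nat \<Rightarrow> state \<Rightarrow> bool" where
  "scanned i j s \<longleftrightarrow> base i (B ^ i) s \<and> fst s ''w'' = B ^ i * k \<and> stab (B ^ i) 0 (snd s ''S'') \<and>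
     fst s ''j'' = j \<and> gtab i j 1 (snd s ''G'')"

lemma scan_triple:
  assumes "i < m" "j < k"
  shows "triple \<Omega> (scanned i j) scan (2 * n * (T + 60) + 30) (scanned i (Suc j))"
proof -
  let ?b = "Neg (Lt (Var ''n'') (Var ''d''))"
  have init: "triple \<Omega> (scanned i j) (Assign ''d'' (Num 1) ;; Assign ''e'' (Num 0) ;; Assign ''v'' (Num 0) ;;
      Assign ''g'' (Add (Var ''k'') (Var ''j''))) 10 (scan_inv i j (2 * n))"
    by (rule triple_straight) (auto simp: scanned_def scan_inv_def base_def)
  have loop: "triple \<Omega> (scan_inv i j (2 * n)) (Loop ?b scan_step) (2 * n * (1 + bcost ?b + (T + 50)) + (1 + bcost ?b))
      (\<lambda>s. (\<exists>c. scan_inv i j c s) \<and> \<not> bval ?b s)"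
    by (rule triple_While[OF scan_step_triple[OF assms]])
  have post: "triple \<Omega> (\<lambda>s. (\<exists>c. scan_inv i j c s) \<and> \<not> bval ?b s) (incr ''j'') 4 (scanned i (Suc j))"
  proof (rule triple_straight)
    fix s assume s: "(\<exists>c. scan_inv i j c s) \<and> \<not> bval ?b s"
    then have "fst s ''d'' = Suc n" by (auto simp: scan_inv_def base_def Let_def)
    then have "gtab i j (Suc n) (snd s ''G'')" using s by (auto simp: scan_inv_def Let_def)
    then show "scanned i (Suc j) (run (incr ''j'') s)"
      using s gtab_next by (auto simp: scan_inv_def Let_def scanned_def base_def incr_def)
  qed (simp_all add: incr_def)
  show ?thesis unfolding scan_def
    by (rule triple_conseq[OF triple_Sequ[OF init triple_Sequ[OF loop post]]])
      (auto simp: algebra_simps)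
qed

definition entry_inv :: "nat \<Rightarrow> nat \<Rightarrow> nat \<Rightarrow> nat \<Rightarrow> state \<Rightarrow> bool" where
  "entry_inv i d r j s \<longleftrightarrow> (let q = d * B ^ i + r in
     base i q s \<and> gtab i k 1 (snd s ''G'') \<and> fst s ''d'' = d \<and> fst s ''g'' = d * k \<and> fst s ''r'' = r \<and>
     fst s ''j'' = j \<and> fst s ''u'' = r * k + j \<and> fst s ''w'' = q * k + j \<and>
     stab q j (snd s ''S'') \<and> best q j (fst s ''b'') (snd s ''L'') (snd s ''X''))"

lemma entry_triple:
  assumes "i < m" "d \<in> {1..n}" "r < B ^ i" "j < k"
  shows "triple \<Omega> (entry_inv i d r j) entry 60 (entry_inv i d r (Suc j))"
proof (rule triple_straight)
  fix s assume s: "entry_inv i d r j s"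
  let ?q = "d * B ^ i + r" and ?V = "fst s" and ?A = "snd s"
  \<comment> \<open>A positive leading digit puts \<open>r\<close> below the current code, so its
    row of \<open>S\<close> is complete.\<close>
  have "1 * B ^ i \<le> d * B ^ i" using assms(2) by (intro mult_right_mono) auto
  then have "r < ?q" using assms(3) by linarith
  then have S: "?A ''S'' (r * k + j) = advance j r"
    using s assms(4) by (auto simp: entry_inv_def stab_def Let_def)
  have G: "?A ''G'' (d * k + j) = rest i j d * B ^ i"
    using s assms by (auto simp: entry_inv_def gtab_def Let_def)
  have z: "?A ''S'' (r * k + j) + ?A ''G'' (d * k + j) = advance j ?q"
    using S G advance_step[of i d r j] assms by simp
  have D: "?A ''D'' = opt_below ?q" using s by (simp add: entry_inv_def base_def Let_def)
  note stab = stab_update[of ?q j "?A ''S''"]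
  let ?y = "opt_below ?q (advance j ?q)"
  show "entry_inv i d r (Suc j) (run entry s)"
  proof (cases "0 < ?y \<and> \<not> (0 < ?V ''b'' \<and> \<not> ?y < ?V ''b'')")
    case True
    then show ?thesis
      using s z D assms(4) stab best_better[OF _ refl, of ?q j "?V ''b''" "?A ''L''" "?A ''X''"]
        linked_update[of ?q "?A ''L''" "?A ''X''"]
      by (simp add: entry_inv_def base_def entry_def incr_def Let_def)
  next
    case False
    then have "best ?q (Suc j) (?V ''b'') (?A ''L'') (?A ''X'')"
      using s best_worse[OF _ refl] by (simp add: entry_inv_def Let_def)
    then show ?thesis
      using s z D assms(4) stab False
      by (auto simp: entry_inv_def base_def entry_def incr_def Let_def)
  qed
qed (simp_all add: entry_def incr_def)

definition row_inv :: "nat \<Rightarrow> nat \<Rightarrow> nat \<Rightarrow> state \<Rightarrow> bool" where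
  "row_inv i d r s \<longleftrightarrow> (let q = d * B ^ i + r in
     base i q s \<and> gtab i k 1 (snd s ''G'') \<and> fst s ''d'' = d \<and> fst s ''g'' = d * k \<and> fst s ''r'' = r \<and>
     fst s ''u'' = r * k \<and> fst s ''w'' = q * k \<and> stab q 0 (snd s ''S''))"

lemma position_less:
  assumes "i < m" "d \<le> n" "r < B ^ i"
  shows "d * B ^ i + r < B ^ m"
proof -
  have "d * B ^ i + r < (d + 1) * B ^ i" unfolding add_mult_distrib mult_1 using assms(3) by linarith
  also have "\<dots> \<le> B * B ^ i" using assms by (intro mult_right_mono) auto
  also have "\<dots> \<le> B ^ m" using assms(1) power_increasing[of "Suc i" m B] by simp
  finally show ?thesis .
qed

lemma row_triple:
  assumes "i < m" "d \<in> {1..n}" "r < B ^ i"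
  shows "triple \<Omega> (row_inv i d r) row (k * 70 + 40) (row_inv i d (Suc r))"
proof -
  let ?b = "Lt (Var ''j'') (Var ''k'')" and ?q = "d * B ^ i + r"
  have q: "0 < ?q" "?q < B ^ m" using assms position_less[of i d r] by auto
  have init: "triple \<Omega> (row_inv i d r) (Assign ''b'' (Num 0) ;; Assign ''j'' (Num 0)) 4 (entry_inv i d r 0)"
    by (rule triple_straight) (auto simp: row_inv_def entry_inv_def base_def Let_def best_start)
  have loop: "triple \<Omega> (entry_inv i d r 0) (Loop ?b entry) (k * (1 + bcost ?b + 60) + (1 + bcost ?b)) (entry_inv i d r k)"
    by (rule triple_For_const[where I = "entry_inv i d r", OF entry_triple[OF assms]]) (auto simp: entry_inv_def base_def Let_def)
  have post: "triple \<Omega> (entry_inv i d r k) 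
     (Cond (Lt (Num 0) (Var ''b'')) (Put ''D'' (Var ''q'') (Add (Var ''b'') (Num 1))) Skip ;; incr ''q'' ;; incr ''r'')
     25 (row_inv i d (Suc r))"
  proof (rule triple_straight)
    fix s assume s: "entry_inv i d r k s"
    have best: "best ?q k (fst s ''b'') (snd s ''L'') (snd s ''X'')"
      using s by (simp add: entry_inv_def Let_def)
    note opt = best_final[OF best q]
    have "linked (Suc ?q) (snd s ''L'') (snd s ''X'')"
      using s linked_Suc[OF _ best q] by (simp add: entry_inv_def base_def Let_def)
    moreover have "stab (Suc ?q) 0 (snd s ''S'')"
      using s stab_next by (simp add: entry_inv_def Let_def)
    \<comment> \<open>Without a usable successor the cell keeps \<open>0\<close>, the value of
      \<open>opt\<close> at unreachable codes.\<close>
    moreover have "opt_below (Suc ?q) = (if 0 < fst s ''b'' then (opt_below ?q)(?q := Suc (fst s ''b'')) else opt_below ?q)"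
      using opt by (auto simp: opt_below_def fun_eq_iff less_Suc_eq)
    ultimately show "row_inv i d (Suc r) (run (Cond (Lt (Num 0) (Var ''b''))
        (Put ''D'' (Var ''q'') (Add (Var ''b'') (Num 1))) Skip ;; incr ''q'' ;; incr ''r'') s)"
      using s by (simp add: entry_inv_def row_inv_def base_def Let_def incr_def)
  qed (simp_all add: incr_def)
  show ?thesis unfolding row_def
    by (rule triple_conseq[OF triple_Sequ[OF init triple_Sequ[OF loop post]]]) auto
qed

text \<open>\<open>l\<close> counts the finished leading digits; digit \<open>0\<close> belongs to
  the earlier layers, hence \<open>d = Suc l\<close>.\<close>

definition block_inv :: "nat \<Rightarrow> nat \<Rightarrow> state \<Rightarrow> bool" where
  "block_inv i l s \<longleftrightarrow> (let d = Suc l; q = d * B ^ i in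
     base i q s \<and> gtab i k 1 (snd s ''G'') \<and> fst s ''d'' = d \<and> fst s ''g'' = d * k \<and>
     fst s ''w'' = q * k \<and> stab q 0 (snd s ''S''))"

lemma block_triple:
  assumes "i < m" "l < n"
  shows "triple \<Omega> (block_inv i l) block (B ^ i * (k * 70 + 50) + 30) (block_inv i (Suc l))"
proof -
  let ?b = "Lt (Var ''r'') (Var ''p'')" and ?d = "Suc l"
  have d: "?d \<in> {1..n}" using assms by simp
  have init: "triple \<Omega> (block_inv i l) (Assign ''r'' (Num 0) ;; Assign ''u'' (Num 0)) 4 (row_inv i ?d 0)"
    by (rule triple_straight) (auto simp: row_inv_def block_inv_def base_def Let_def)
  have loop: "triple \<Omega> (row_inv i ?d 0) (Loop ?b row) (B ^ i * (1 + bcost ?b + (k * 70 + 40)) + (1 + bcost ?b)) (row_inv i ?d (B ^ i))"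
    by (rule triple_For_const[where I = "row_inv i ?d", OF row_triple[OF assms(1) d]]) (auto simp: row_inv_def base_def Let_def)
  have post: "triple \<Omega> (row_inv i ?d (B ^ i)) (incr ''d'' ;; Assign ''g'' (Add (Var ''g'') (Var ''k''))) 10
     (block_inv i (Suc l))"
    by (rule triple_straight)
      (auto simp: row_inv_def block_inv_def base_def Let_def incr_def algebra_simps)
  show ?thesis unfolding block_def
    by (rule triple_conseq[OF triple_Sequ[OF init triple_Sequ[OF loop post]]]) (auto simp: algebra_simps)
qed

definition layer_inv :: "nat \<Rightarrow> state \<Rightarrow> bool" where
  "layer_inv i s \<longleftrightarrow> base i (B ^ i) s \<and> fst s ''w'' = B ^ i * k \<and> stab (B ^ i) 0 (snd s ''S'')"

lemma layer_triple:
  assumes "i < m"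
  shows "triple \<Omega> (layer_inv i) layer
    (k * (2 * n * (T + 60) + 40) + n * (B ^ i * (k * 70 + 50) + 40) + 50) (layer_inv (Suc i))"
proof -
  let ?b = "Lt (Var ''j'') (Var ''k'')" and ?b' = "Neg (Lt (Var ''n'') (Var ''d''))"
  have init: "triple \<Omega> (layer_inv i) (Assign ''j'' (Num 0)) 2 (scanned i 0)"
    by (rule triple_straight) (auto simp: layer_inv_def scanned_def base_def gtab_start)
  have loop: "triple \<Omega> (scanned i 0) (Loop ?b scan)
      (k * (1 + bcost ?b + (2 * n * (T + 60) + 30)) + (1 + bcost ?b)) (scanned i k)"
    by (rule triple_For_const[where I = "scanned i", OF scan_triple[OF assms]]) (auto simp: scanned_def base_def)
  have mid: "triple \<Omega> (scanned i k) (Assign ''d'' (Num 1) ;; Assign ''g'' (Var ''k'')) 5 (block_inv i 0)"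
    by (rule triple_straight) (auto simp: scanned_def block_inv_def base_def Let_def)
  have loop': "triple \<Omega> (block_inv i 0) (Loop ?b' block)
      (n * (1 + bcost ?b' + (B ^ i * (k * 70 + 50) + 30)) + (1 + bcost ?b')) (block_inv i n)"
    by (rule triple_For_const[where I = "block_inv i", OF block_triple[OF assms]]) (auto simp: block_inv_def base_def Let_def)
  have post: "triple \<Omega> (block_inv i n) (Assign ''p'' (Var ''q'') ;; incr ''i'') 10 (layer_inv (Suc i))"
    by (rule triple_straight)
      (auto simp: layer_inv_def block_inv_def base_def Let_def incr_def)
  show ?thesis unfolding layer_def
    by (rule triple_conseq[OF triple_Sequ[OF init triple_Sequ[OF loop triple_Sequ[OF mid
          triple_Sequ[OF loop' post]]]]]) (auto simp: algebra_simps)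
qed

definition fill_time :: nat where
  "fill_time = (\<Sum>i<(if n = 0 then 0 else m).
     k * (2 * n * (T + 60) + 40) + n * (B ^ i * (k * 70 + 50) + 40) + 60) + 30"

lemma fill_triple:
  "triple \<Omega> (\<lambda>s. s = input_state m n k) fill fill_time
     (\<lambda>s. fst s ''m'' = m \<and> fst s ''found'' = 0 \<and> fst s ''p'' = B ^ m \<and> snd s ''D'' = opt_below (B ^ m) \<and>
       linked (B ^ m) (snd s ''L'') (snd s ''X''))"
proof -
  let ?M = "if n = 0 then 0 else m" and ?b = "Conj (Lt (Num 0) (Var ''n'')) (Lt (Var ''i'') (Var ''m''))"
  let ?t = "\<lambda>i. k * (2 * n * (T + 60) + 40) + n * (B ^ i * (k * 70 + 50) + 40) + 50"
  have init: "triple \<Omega> (\<lambda>s. s = input_state m n k)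
     (Assign ''p'' (Num 1) ;; Assign ''q'' (Num 1) ;; Assign ''w'' (Var ''k'') ;; Put ''D'' (Num 0) (Num 1)) 10
     (layer_inv 0)"
  proof (rule triple_straight)
    fix s assume "s = input_state m n k"
    moreover have "opt_below 1 = (\<lambda>_. 0)(0 := 1)" by (auto simp: opt_below_def opt_0 fun_eq_iff)
    moreover have "linked 1 (\<lambda>_. 0) (\<lambda>_. 0)" by (simp add: linked_def)
    ultimately show "layer_inv 0 (run (Assign ''p'' (Num 1) ;; Assign ''q'' (Num 1) ;;
        Assign ''w'' (Var ''k'') ;; Put ''D'' (Num 0) (Num 1)) s)"
      using stab_start by (simp add: layer_inv_def base_def input_state_def)
  qed simp_all
  have loop: "triple \<Omega> (layer_inv 0) (Loop ?b layer) ((\<Sum>i<?M. 1 + bcost ?b + ?t i) + (1 + bcost ?b)) (layer_inv ?M)"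
    by (rule triple_For[where I = layer_inv, OF layer_triple])
      (auto simp: layer_inv_def base_def split: if_splits)
  \<comment> \<open>For \<open>n = 0\<close> the base is \<open>1\<close> and \<open>0\<close> is
    the only code, so skipping the layers leaves no code untreated.\<close>
  have M: "B ^ ?M = B ^ m" by simp
  have "(\<Sum>i<?M. 1 + bcost ?b + ?t i) \<le> (\<Sum>i<?M. ?t i + 10)" by (rule sum_mono) simp
  then have time: "10 + ((\<Sum>i<?M. 1 + bcost ?b + ?t i) + (1 + bcost ?b)) \<le> fill_time"
    unfolding fill_time_def by (simp add: add.assoc)
  show ?thesis unfolding fill_def
    by (rule triple_conseq[OF triple_Sequ[OF init loop] _ time])
      (use M in \<open>auto simp: layer_inv_def base_def\<close>)
qed

section \<open>Output of the chain diagram\<close>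

definition edge_set :: "(nat \<Rightarrow> nat) \<Rightarrow> (nat \<Rightarrow> nat) \<Rightarrow> nat \<Rightarrow> (nat \<times> nat) set" where
  "edge_set f g e = {(f x, g x) | x. x < e}"

lemma edge_set_0 [simp]: "edge_set f g 0 = {}"
  by (simp add: edge_set_def)

lemma edge_set_Suc [simp]:
  "edge_set (f(e := a)) (g(e := b)) (Suc e) = insert (a, b) (edge_set f g e)"
  by (auto simp: edge_set_def less_Suc_eq)

definition header :: "nat \<Rightarrow> state \<Rightarrow> bool" where
  "header L s \<longleftrightarrow> fst s ''m'' = m \<and> fst s ''found'' = 1 \<and> fst s ''l'' = Suc L \<and> fst s ''nodes'' = L + 2 \<and>
     fst s ''sink'' = Suc L \<and> fst s ''source'' = 0"

definition walk_inv :: "(nat \<Rightarrow> nat) \<Rightarrow> (nat \<Rightarrow> nat) \<Rightarrow> nat \<Rightarrow> nat \<Rightarrow> state \<Rightarrow> bool" where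
  "walk_inv l x L t s \<longleftrightarrow> header L s \<and> snd s ''L'' = l \<and> snd s ''X'' = x \<and>
     fst s ''v'' = Suc t \<and> fst s ''q'' = (x ^^ t) start \<and>
     (\<forall>u\<in>{1..t}. snd s ''label'' u = l ((x ^^ (u - 1)) start))"

lemma walk_step_triple: "triple \<Omega> (walk_inv l x L t) walk_step 20 (walk_inv l x L (Suc t))"
  by (rule triple_straight)
    (auto simp: walk_inv_def header_def walk_step_def incr_def le_Suc_eq)

definition labelled :: "(nat \<Rightarrow> nat) \<Rightarrow> nat \<Rightarrow> state \<Rightarrow> bool" where
  "labelled lab L s \<longleftrightarrow> header L s \<and> (\<forall>u\<in>{1..L}. snd s ''label'' u = lab u)"

definition edges_inv :: "(nat \<Rightarrow> nat) \<Rightarrow> nat \<Rightarrow> nat \<Rightarrow> state \<Rightarrow> bool" where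
  "edges_inv lab L t s \<longleftrightarrow> labelled lab L s \<and> fst s ''v'' = Suc t \<and>
     edge_set (snd s ''tail'') (snd s ''head'') (fst s ''e'') = {(u, v) \<in> chain_edges (Suc L). v \<le> t}"

definition first_tail :: "nat \<Rightarrow> nat" where
  "first_tail t = (if m < 2 then t else 0)"

definition edge_inv :: "(nat \<Rightarrow> nat) \<Rightarrow> nat \<Rightarrow> nat \<Rightarrow> nat \<Rightarrow> state \<Rightarrow> bool" where
  "edge_inv lab L t a s \<longleftrightarrow> labelled lab L s \<and> fst s ''v'' = Suc t \<and> fst s ''u'' = first_tail t + a \<and>
     edge_set (snd s ''tail'') (snd s ''head'') (fst s ''e'') =
       {(u, v) \<in> chain_edges (Suc L). v \<le> t} \<union> {first_tail t..<first_tail t + a} \<times> {Suc t}"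

lemma edge_triple: "triple \<Omega> (edge_inv lab L t a) edge 20 (edge_inv lab L t (Suc a))"
  by (rule triple_straight)
    (auto simp: edge_inv_def labelled_def header_def edge_def incr_def)

lemma edge_row_triple:
  assumes "t < Suc L"
  shows "triple \<Omega> (edges_inv lab L t) edge_row ((if m < 2 then 1 else Suc L) * 30 + 30) (edges_inv lab L (Suc t))"
proof -
  let ?N = "Suc t - first_tail t" and ?b = "Lt (Var ''u'') (Var ''v'')"
  have init: "triple \<Omega> (edges_inv lab L t)
     (Cond (Lt (Var ''m'') (Num 2)) (Assign ''u'' (Sub (Var ''v'') (Num 1))) (Assign ''u'' (Num 0))) 12
     (edge_inv lab L t 0)"
    by (rule triple_straight)
      (auto simp: edges_inv_def edge_inv_def labelled_def header_def first_tail_def)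
  have loop: "triple \<Omega> (edge_inv lab L t 0) (Loop ?b edge) (?N * (1 + bcost ?b + 20) + (1 + bcost ?b)) (edge_inv lab L t ?N)"
    by (rule triple_For_const[where I = "edge_inv lab L t", OF edge_triple]) (auto simp: edge_inv_def)
  have "{(u, v) \<in> chain_edges (Suc L). v \<le> t} \<union> {first_tail t..<first_tail t + ?N} \<times> {Suc t}
     = {(u, v) \<in> chain_edges (Suc L). v \<le> Suc t}"
    using assms by (auto simp: chain_edges_def first_tail_def le_Suc_eq)
  then have post: "triple \<Omega> (edge_inv lab L t ?N) (incr ''v'') 4 (edges_inv lab L (Suc t))"
    by (intro triple_straight)
      (simp_all add: edges_inv_def edge_inv_def labelled_def header_def incr_def)
  have "?N \<le> (if m < 2 then 1 else Suc L)" using assms by (simp add: first_tail_def)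
  then show ?thesis unfolding edge_row_def
    by (intro triple_conseq[OF triple_Sequ[OF init triple_Sequ[OF loop post]]]) auto
qed

definition emit_time :: "nat \<Rightarrow> nat" where
  "emit_time L = L * 30 + Suc L * ((if m < 2 then 1 else Suc L) * 30 + 40) + 60"

lemma emit_triple:
  assumes opt: "opt start = Suc L"
  shows "triple \<Omega> (\<lambda>s. fst s ''m'' = m \<and> fst s ''p'' = B ^ m \<and> snd s ''D'' = opt_below (B ^ m) \<and>
       snd s ''L'' = l \<and> snd s ''X'' = x) emit (emit_time L)
     (\<lambda>s. labelled (\<lambda>u. l ((x ^^ (u - 1)) start)) L s \<and>
       edge_set (snd s ''tail'') (snd s ''head'') (fst s ''edges'') = chain_edges (Suc L))"
    (is "triple _ ?P _ _ ?Q")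
proof -
  let ?lab = "\<lambda>u. l ((x ^^ (u - 1)) start)"
  let ?b = "Lt (Var ''v'') (Var ''l'')" and ?b' = "Neg (Lt (Var ''l'') (Var ''v''))"
  have D: "opt_below (B ^ m) (B ^ m - Suc 0) = Suc L"
    using opt start_less by (simp add: opt_below_def start_def)
  have init: "triple \<Omega> ?P
     (Assign ''found'' (Num 1) ;; Assign ''l'' (Get ''D'' (Sub (Var ''p'') (Num 1))) ;;
      Assign ''nodes'' (Add (Var ''l'') (Num 1)) ;; Assign ''sink'' (Var ''l'') ;; Assign ''source'' (Num 0) ;;
      Assign ''q'' (Sub (Var ''p'') (Num 1)) ;; Assign ''v'' (Num 1)) 30 (walk_inv l x L 0)"
    by (rule triple_straight)
      (auto simp: walk_inv_def header_def D start_def)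
  have loop: "triple \<Omega> (walk_inv l x L 0) (Loop ?b walk_step) (L * (1 + bcost ?b + 20) + (1 + bcost ?b)) (walk_inv l x L L)"
    by (rule triple_For_const[where I = "walk_inv l x L", OF walk_step_triple])
      (auto simp: walk_inv_def header_def)
  have mid: "triple \<Omega> (walk_inv l x L L) (Assign ''v'' (Num 1) ;; Assign ''e'' (Num 0)) 4 (edges_inv ?lab L 0)"
    by (rule triple_straight)
      (auto simp: walk_inv_def edges_inv_def labelled_def header_def chain_edges_def)
  have loop': "triple \<Omega> (edges_inv ?lab L 0) (Loop ?b' edge_row)
     (Suc L * (1 + bcost ?b' + ((if m < 2 then 1 else Suc L) * 30 + 30)) + (1 + bcost ?b')) (edges_inv ?lab L (Suc L))"
    by (rule triple_For_const[where I = "edges_inv ?lab L", OF edge_row_triple])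
      (auto simp: edges_inv_def labelled_def header_def)
  have "{(u, v) \<in> chain_edges (Suc L). v \<le> Suc L} = chain_edges (Suc L)"
    by (auto simp: chain_edges_def)
  then have post: "triple \<Omega> (edges_inv ?lab L (Suc L)) (Assign ''edges'' (Var ''e'')) 2 ?Q"
    by (intro triple_straight) (simp_all add: edges_inv_def labelled_def header_def)
  show ?thesis unfolding emit_def emit_time_def
    by (rule triple_conseq[OF triple_Sequ[OF init triple_Sequ[OF loop triple_Sequ[OF mid
          triple_Sequ[OF loop' post]]]]]) (auto simp: algebra_simps)
qed

text \<open>Optimality: a valid competitor yields a word two letters shorter than its size, and no
  word from \<open>start\<close> to \<open>0\<close> is shorter than \<open>L\<close>.\<close>

lemma emitted_diagram:
  assumes "linked (B ^ m) l x" "opt start = Suc L"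
    "labelled (\<lambda>u. l ((x ^^ (u - 1)) start)) L s"
    "edge_set (snd s ''tail'') (snd s ''head'') (fst s ''edges'') = chain_edges (Suc L)"
  shows "\<exists>F. outputs_diagram Cs s F \<and> minimum_valid (set Cs) Ts F"
proof -
  define js where "js = map (\<lambda>t. l ((x ^^ t) start)) [0..<L]"
  have js: "set js \<subseteq> {..<k}" "fold advance js start = 0" "progress advance js start"
    using linked_chain[OF assms(1) start_less assms(2)] unfolding js_def by simp_all
  have len: "length js = L" by (simp add: js_def)
  define F :: "'a flow_diagram" where
    "F = \<lparr>fd_nodes = {..L + 1}, fd_edges = chain_edges (L + 1), fd_source = 0, fd_sink = L + 1,
          fd_label = (\<lambda>v. Cs ! (js ! (v - 1)))\<rparr>"
  have F: "is_flow_diagram (set Cs) F \<and> valid_for Ts F"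
    by (rule chain_diagram_valid[OF js]) (simp_all add: F_def len)
  have "fd_size F \<le> fd_size F'" if F': "is_flow_diagram (set Cs) F'" "valid_for Ts F'" for F'
  proof -
    from valid_diagram_reach[OF F'] obtain L' where "reach L' start" "fd_size F' = L' + 2" by blast
    then show ?thesis using opt_le[of L' start] assms(2) by (simp add: fd_size_def F_def)
  qed
  then have "minimum_valid (set Cs) Ts F" using F by (simp add: minimum_valid_def)
  moreover have "outputs_diagram Cs s F"
  proof -
    have inner: "inner_nodes F = {1..L}" by (auto simp: inner_nodes_def F_def)
    have "snd s ''label'' v < k \<and> fd_label F v = Cs ! snd s ''label'' v" if v: "v \<in> {1..L}" for v
    proof -
      have eq: "snd s ''label'' v = js ! (v - 1)"
        using assms(3) v by (auto simp: labelled_def js_def)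
      have "js ! (v - 1) \<in> set js" using v len by auto
      then have "js ! (v - 1) < k" using js(1) by blast
      then show ?thesis by (simp add: eq F_def)
    qed
    then show ?thesis
      using assms(3,4) unfolding outputs_diagram_def inner
      by (auto simp: F_def labelled_def header_def edge_set_def)
  qed
  ultimately show ?thesis by blast
qed

lemma program_correct:
  "\<exists>t s L. exec \<Omega> program (input_state m n k) t s \<and> L \<le> m * n \<and> t \<le> fill_time + emit_time L + 10 \<and>
     (if \<exists>F. is_flow_diagram (set Cs) F \<and> valid_for Ts F
      then \<exists>F. outputs_diagram Cs s F \<and> minimum_valid (set Cs) Ts F
      else outputs_infeasible s)"
proof -
  let ?b = "Lt (Num 0) (Get ''D'' (Sub (Var ''p'') (Num 1)))"
  obtain t s where 1: "exec \<Omega> fill (input_state m n k) t s" "t \<le> fill_time"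
    "fst s ''m'' = m" "fst s ''found'' = 0" "fst s ''p'' = B ^ m" "snd s ''D'' = opt_below (B ^ m)"
    "linked (B ^ m) (snd s ''L'') (snd s ''X'')"
    using fill_triple unfolding triple_def by blast
  have b: "bval ?b s \<longleftrightarrow> 0 < opt start"
    using 1 start_less by (simp add: opt_below_def start_def)
  show ?thesis
  proof (cases "opt start")
    case 0
    then have nb: "\<not> bval ?b s" using b by simp
    \<comment> \<open>A valid diagram would yield a word from \<open>start\<close> to
      \<open>0\<close>, against the stored \<open>0\<close>.\<close>
    have "\<not> (\<exists>F. is_flow_diagram (set Cs) F \<and> valid_for Ts F)"
      using valid_diagram_reach opt_le[of _ start] 0 by (metis less_irrefl)
    moreover have "exec \<Omega> program (input_state m n k) (t + (1 + bcost ?b + 1)) s"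
      unfolding program_def by (rule exec.Sequ[OF 1(1) exec.Cond_False[OF nb exec.Skip]])
    moreover have "t + (1 + bcost ?b + 1) \<le> fill_time + emit_time 0 + 10" using 1(2) by simp
    moreover have "outputs_infeasible s" using 1(4) by (simp add: outputs_infeasible_def)
    ultimately show ?thesis by (metis zero_le)
  next
    case (Suc L)
    then have bt: "bval ?b s" using b by simp
    obtain u s' where 2: "exec \<Omega> emit s u s'" "u \<le> emit_time L"
      "labelled (\<lambda>u. snd s ''L'' ((snd s ''X'' ^^ (u - 1)) start)) L s'"
      "edge_set (snd s' ''tail'') (snd s' ''head'') (fst s' ''edges'') = chain_edges (Suc L)"
      using emit_triple[OF Suc, of "snd s ''L''" "snd s ''X''"] 1 unfolding triple_def by blast
    have F: "\<exists>F. outputs_diagram Cs s' F \<and> minimum_valid (set Cs) Ts F"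
      by (rule emitted_diagram[OF 1(7) Suc 2(3,4)])
    then have "\<exists>F. is_flow_diagram (set Cs) F \<and> valid_for Ts F" unfolding minimum_valid_def by blast
    moreover have "exec \<Omega> program (input_state m n k) (t + (1 + bcost ?b + u)) s'"
      unfolding program_def by (rule exec.Sequ[OF 1(1) exec.Cond_True[OF bt 2(1)]])
    moreover have "t + (1 + bcost ?b + u) \<le> fill_time + emit_time L + 10" using 1(2) 2(2) by simp
    \<comment> \<open>Bounds the size of the output, and so the cost of writing it.\<close>
    moreover have "L \<le> m * n"
      using linked_chain[OF 1(7) start_less Suc] progress_start_length by fastforce
    ultimately show ?thesis using F by metis
  qed
qed

text \<open>The layer sizes form a geometric series, so the tables cost the order of
  \<open>k * (n + 1) ^ m\<close>; the scans make \<open>2 * n\<close> checks per sequence and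
  criterion; the output is quadratic in \<open>L\<close> only for \<open>m\<close> at least
  \<open>2\<close>, where \<open>m * (n + 1) ^ m\<close> pays for it.\<close>

lemma time_bound:
  assumes L: "L \<le> m * n"
  shows "fill_time + emit_time L + 10 \<le> 2000 * max 1 (m * n * k * T + (k + m) * (n + 1) ^ m)"
proof (cases "m = 0 \<or> n = 0")
  \<comment> \<open>No layer is run and the cost is constant; the maximum with \<open>1\<close>
    covers \<open>k + m = 0\<close>.\<close>
  case True
  then have "L = 0" using L by auto
  moreover have "fill_time = 30" using True by (auto simp: fill_time_def)
  ultimately have "fill_time + emit_time L + 10 \<le> 2000" by (simp add: emit_time_def)
  moreover have "2000 * 1 \<le> 2000 * max 1 (m * n * k * T + (k + m) * (n + 1) ^ m)"
    by (rule mult_le_mono2) simp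
  ultimately show ?thesis by linarith
next
  case False
  then have pos: "1 \<le> m" "1 \<le> n" by linarith+
  define N where "N = B ^ m"
  \<comment> \<open>Bernoulli's inequality, used with exponents \<open>m\<close> and
    \<open>m - 2\<close>.\<close>
  have bern: "1 + a * n \<le> B ^ a" for a
  proof (induction a)
    case (Suc a)
    have "1 + Suc a * n \<le> (1 + a * n) * B" by (simp add: algebra_simps)
    also have "\<dots> \<le> B ^ a * B" using Suc by (intro mult_right_mono) auto
    finally show ?case by (simp add: mult.commute)
  qed simp
  have mn: "m * n \<le> N" using bern[of m] by (simp add: N_def)
  have mn': "m \<le> m * n" using pos by simp
  have N: "1 \<le> N" by (simp add: N_def)
  have m_le: "m \<le> N" and mk: "m * k \<le> k * N" and mnk: "m * n * k \<le> k * N" and NmN: "N \<le> m * N"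
    using mn pos by (auto intro: order.trans[of m "m * n"])
  \<comment> \<open>The sum telescopes because \<open>n = B - 1\<close>; this keeps a factor
    \<open>m\<close> away from \<open>k * N\<close>.\<close>
  have "(\<Sum>i<a. n * B ^ i) + 1 = B ^ a" for a
    by (induction a) (auto simp: algebra_simps)
  then have geo: "(\<Sum>i<m. n * B ^ i) \<le> N" unfolding N_def by (metis le_add1)
  have "fill_time = (\<Sum>i<m. k * (2 * n * (T + 60) + 40) + (k * 70 + 50) * (n * B ^ i) + 40 * n + 60) + 30"
    using pos by (simp add: fill_time_def algebra_simps)
  also have "\<dots> = m * (k * (2 * n * (T + 60) + 40)) + (k * 70 + 50) * (\<Sum>i<m. n * B ^ i) + 40 * (m * n) + 60 * m + 30"
    by (simp add: sum.distrib sum_distrib_left)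
  also have "m * (k * (2 * n * (T + 60) + 40)) = 2 * (m * n * k * T) + 120 * (m * n * k) + 40 * (m * k)"
    by (simp add: algebra_simps)
  also have "(k * 70 + 50) * (\<Sum>i<m. n * B ^ i) \<le> (k * 70 + 50) * N"
    using geo by (rule mult_left_mono) simp
  also have "(k * 70 + 50) * N = 70 * (k * N) + 50 * N" by (simp add: algebra_simps)
  finally have fill: "fill_time \<le> 2 * (m * n * k * T) + 230 * (k * N) + 180 * N"
    using mn m_le mk mnk N by linarith
  have emit: "emit_time L \<le> 410 * (m * N)"
  proof (cases "m < 2")
    case True
    then have "emit_time L = 100 * L + 130" by (simp add: emit_time_def)
    then show ?thesis using L mn N NmN by linarith
  next
    case False
    then obtain a where a: "m = a + 2" by (metis add.commute le_Suc_ex linorder_not_less)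
    \<comment> \<open>Two of the factors \<open>B\<close> of \<open>N\<close> absorb
      \<open>n * n\<close>. The other \<open>a\<close> of them absorb \<open>m\<close> by Bernoulli,
      as \<open>a + 2\<close> is at most \<open>2 * (1 + a * n)\<close>.\<close>
    have "m * (n * n) \<le> (2 * (1 + a * n)) * (B * B)"
      using pos(2) by (intro mult_mono) (auto simp: a)
    also have "\<dots> \<le> (2 * B ^ a) * (B * B)" using bern[of a] by (intro mult_right_mono) auto
    also have "\<dots> = 2 * N" by (simp add: N_def a power_add algebra_simps)
    finally have sq: "m * (m * (n * n)) \<le> 2 * (m * N)" by (metis mult.left_commute mult_le_mono2)
    have "Suc L \<le> 2 * (m * n)" using L mn' pos by linarith
    then have "Suc L * Suc L \<le> (2 * (m * n)) * (2 * (m * n))" by (intro mult_mono) auto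
    also have "\<dots> = 4 * (m * (m * (n * n)))" by (simp add: algebra_simps)
    finally have "Suc L * Suc L \<le> 8 * (m * N)" using sq by linarith
    moreover have "emit_time L = 30 * (Suc L * Suc L) + 70 * L + 100"
      using False by (simp add: emit_time_def algebra_simps)
    ultimately show ?thesis using L mn N NmN by linarith
  qed
  have "fill_time + emit_time L + 10 \<le> 2000 * (m * n * k * T + (k * N + m * N))"
    using fill emit N NmN unfolding add_mult_distrib2 by linarith
  also have "k * N + m * N = (k + m) * (n + 1) ^ m" by (simp add: N_def algebra_simps)
  finally show ?thesis by (meson le_trans max.cobounded2 mult_le_mono2)
qed

end

theorem theorem4:
  "\<exists>(p :: com) (c :: nat).
     \<forall>(Ts :: 's list list) (Cs :: 's criterion list) (m :: nat) (n :: nat) (k :: nat)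
       (\<theta> :: 's criterion \<Rightarrow> 's list \<Rightarrow> nat) (T1n :: nat).
       length Ts = m \<and> (\<forall>\<tau>\<in>set Ts. length \<tau> = n) \<and>
       length Cs = k \<and>
       (\<forall>C\<in>set Cs. independent_criterion C \<and> monotone_decreasing_criterion C) \<and>
       (\<forall>C\<in>set Cs. \<forall>\<sigma>. length \<sigma> \<le> n \<longrightarrow> \<theta> C \<sigma> \<le> T1n)
       \<longrightarrow>
       (\<exists>t s. exec (check_oracle Ts Cs \<theta>) p (input_state m n k) t s \<and>
          t \<le> c * max 1 (m * n * k * T1n + (k + m) * (n + 1) ^ m) \<and>
          (if \<exists>F. is_flow_diagram (set Cs) F \<and> valid_for Ts F
           then \<exists>F. outputs_diagram Cs s F \<and> minimum_valid (set Cs) Ts F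
           else outputs_infeasible s))"
proof (rule exI[of _ program], rule exI[of _ 2000], intro allI impI, elim conjE)
  fix Ts :: "'s list list" and Cs :: "'s criterion list" and m n k T1n
    and \<theta> :: "'s criterion \<Rightarrow> 's list \<Rightarrow> nat"
  assume a: "length Ts = m" "\<forall>\<tau>\<in>set Ts. length \<tau> = n" "length Cs = k"
    "\<forall>C\<in>set Cs. independent_criterion C \<and> monotone_decreasing_criterion C"
    "\<forall>C\<in>set Cs. \<forall>\<sigma>. length \<sigma> \<le> n \<longrightarrow> \<theta> C \<sigma> \<le> T1n"
  interpret flow_run Ts Cs n \<theta> T1n by standard (use a in auto)
  show "\<exists>t s. exec (check_oracle Ts Cs \<theta>) program (input_state m n k) t s \<and>
          t \<le> 2000 * max 1 (m * n * k * T1n + (k + m) * (n + 1) ^ m) \<and>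
          (if \<exists>F. is_flow_diagram (set Cs) F \<and> valid_for Ts F
           then \<exists>F. outputs_diagram Cs s F \<and> minimum_valid (set Cs) Ts F
           else outputs_infeasible s)"
    using program_correct time_bound unfolding a(1,3) by (meson le_trans)
qed

end
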